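(* Let $D:f=0$ be a reduced surface of degree $d$ in $\mathbb{P}^3$ which is not a cone and which is free with exponents $1\leq d_1\leq d_2\leq d_3$, i.e. the minimal graded free resolution of the Milnor algebra $M(f)$ has the form $$0\to \bigoplus_{j=1}^{3}S(-(d-1)-d_j)\to S(-(d-1))^4\to S.$$ Then: (i) $d_1+d_2+d_3=d-1$, $mdr(f)=d_1$, $ct(f)=d_1+d-2$ and $st(f)=d+d_3-4$. (ii) The Hilbert polynomial of $M(f)$ is $P(M(f))(k)=ak+b$ with $$a=s_1^2-s_2,\qquad b=2a-s_1^3+\frac{3}{2}s_1s_2-\frac{1}{2}s_3,$$ where $s_1=d_1+d_2+d_3$, $s_2=d_1d_2+d_1d_3+d_2d_3$ and $s_3=d_1d_2d_3$.
   Context: $S=\mathbb{C}[x,y,z,w]$ with the standard grading; $f\in S$ is homogeneous of degree $d$; $J_f$ is the Jacobian ideal generated by the partial derivatives $f_x,f_y,f_z,f_w$; $M(f)=S/J_f$ is the graded Milnor algebra. $H(M(f))(k)=\dim_{\mathbb{C}} M(f)_k$ is its Hilbert function and $P(M(f))$ its Hilbert polynomial, i.e. the unique polynomial with $H(M(f))(k)=P(M(f))(k)$ for all large $k$. $D$ is a cone if, after a linear change of coordinates, $f$ does not depend on one of the variables. $AR(f)=\{(a_0,a_1,a_2,a_3)\in S^4: a_0f_x+a_1f_y+a_2f_z+a_3f_w=0\}$, graded by the degree of the components. $D$ is free if $AR(f)$ is a free graded $S$-module (of rank 3); the degrees $d_1\le d_2\le d_3$ of a homogeneous basis are the exponents.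 Invariants: - $st(f)=\min\{q: H(M(f))(k)=P(M(f))(k)\text{ for all }k\geq q\}$. - $ct(f)=\max\{q:\dim M(f)_k=\dim M(f_s)_k\text{ for all }k\leq q\}$, where $f_s\in S$ is any homogeneous polynomial of degree $d$ defining a smooth surface in $\mathbb{P}^3$. - $mdr(f)=\min\{q: H^3(K^*(f))_{q+3}\neq 0\}$, where $K^*(f)$ is the Koszul complex of $f_x,f_y,f_z,f_w$ with its natural grading; explicitly, $H^3(K^*(f))_{q+3}=AR(f)_q/KR(f)_q$, where $KR(f)\subset AR(f)$ is the submodule generated by the Koszul (trivial) relations $f_je_i-f_ie_j$. *)

theory Defs
  imports
    "HOL-Analysis.Analysis"
    "HOL-Library.Poly_Mapping"
    "HOL-Computational_Algebra.Polynomial"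
    "HOL-Computational_Algebra.Squarefree"
begin

abbreviation (input) "lookup \<equiv> Poly_Mapping.lookup"
abbreviation (input) "keys \<equiv> Poly_Mapping.keys"

text \<open>
  The ring \<open>S = \<complex>[x, y, z, w]\<close>, with the four variables indexed by the four-element
  type \<open>4\<close>: a polynomial maps exponent vectors to coefficients.
\<close>

type_synonym mon = "4 \<Rightarrow>\<^sub>0 nat"
type_synonym quat_poly = "mon \<Rightarrow>\<^sub>0 complex"

definition mon_degree :: "mon \<Rightarrow> nat" where
  "mon_degree m = (\<Sum>i\<in>UNIV. lookup m i)"

text \<open>The zero polynomial is homogeneous of every degree.\<close>

definition homogeneous :: "nat \<Rightarrow> quat_poly \<Rightarrow> bool" where
  "homogeneous k p \<longleftrightarrow> (\<forall>m\<in>keys p. mon_degree m = k)"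

definition graded_piece :: "nat \<Rightarrow> quat_poly set" where
  "graded_piece k = {p. homogeneous k p}"

definition const :: "complex \<Rightarrow> quat_poly" where
  "const c = Poly_Mapping.single 0 c"

text \<open>
  For \<open>m i = 0\<close> the coefficient \<open>m i\<close> vanishes, so the truncated subtraction in the
  exponent is harmless.
\<close>

definition partial :: "4 \<Rightarrow> quat_poly \<Rightarrow> quat_poly" where
  "partial i p =
     (\<Sum>m\<in>keys p. Poly_Mapping.single (m - Poly_Mapping.single i 1)
                    (of_nat (lookup m i) * lookup p m))"

text \<open>
  Substitution of elements \<open>x i\<close> of a commutative ring for the variables, the
  coefficients being mapped to that ring by \<open>h\<close>.
\<close>

definition substitute ::
  "(complex \<Rightarrow> 'a::comm_semiring_1) \<Rightarrow> (4 \<Rightarrow> 'a) \<Rightarrow> quat_poly \<Rightarrow> 'a" where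
  "substitute h x p = (\<Sum>m\<in>keys p. h (lookup p m) * (\<Prod>i\<in>UNIV. x i ^ lookup m i))"

definition eval_at :: "quat_poly \<Rightarrow> complex ^ 4 \<Rightarrow> complex" where
  "eval_at p v = substitute (\<lambda>c. c) (\<lambda>i. v $ i) p"

definition variable :: "4 \<Rightarrow> quat_poly" where
  "variable i = Poly_Mapping.single (Poly_Mapping.single i 1) 1"

definition linear_change :: "complex ^ 4 ^ 4 \<Rightarrow> quat_poly \<Rightarrow> quat_poly" where
  "linear_change A p = substitute const (\<lambda>i. \<Sum>j\<in>UNIV. const (A $ i $ j) * variable j) p"

definition is_cone :: "quat_poly \<Rightarrow> bool" where
  "is_cone f \<longleftrightarrow>
     (\<exists>A. invertible A \<and> (\<exists>j. \<forall>m\<in>keys (linear_change A f). lookup m j = 0))"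

text \<open>
  Jacobian criterion: no point of the projective surface \<open>f = 0\<close> annihilates all partial
  derivatives.
\<close>

definition smooth_surface :: "quat_poly \<Rightarrow> bool" where
  "smooth_surface f \<longleftrightarrow>
     (\<forall>v. v \<noteq> 0 \<and> eval_at f v = 0 \<longrightarrow> (\<exists>i. eval_at (partial i f) v \<noteq> 0))"

text \<open>
  Three module structures: \<open>S\<close> over itself (so that spans are ideals), \<open>S\<^sup>4\<close> over \<open>S\<close>,
  and \<open>S\<close> as a complex vector space.
\<close>

interpretation ideal: module "(*) :: quat_poly \<Rightarrow> quat_poly \<Rightarrow> quat_poly"
  by standard (rule distrib_left distrib_right mult.assoc[symmetric] mult_1_left)+

interpretation S4: module "(*s) :: quat_poly \<Rightarrow> quat_poly ^ 4 \<Rightarrow> quat_poly ^ 4"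
  by standard
    (rule vector_add_ldistrib vector_sadd_rdistrib vector_smult_assoc vector_smult_lid)+

definition cscale :: "complex \<Rightarrow> quat_poly \<Rightarrow> quat_poly" where
  "cscale c p = const c * p"

lemma const_add: "const (a + b) = const a + const b"
  unfolding const_def by (rule single_add)

lemma const_mult: "const (a * b) = const a * const b"
  unfolding const_def mult_single by (simp only: add_0_left)

interpretation CS: vector_space cscale
proof
  show "cscale a (x + y) = cscale a x + cscale a y" for a x y
    unfolding cscale_def by (rule distrib_left)
  show "cscale (a + b) x = cscale a x + cscale b x" for a b x
    unfolding cscale_def const_add by (rule distrib_right)
  show "cscale a (cscale b x) = cscale (a * b) x" for a b x
    unfolding cscale_def const_mult by (rule mult.assoc[symmetric])
  show "cscale 1 x = x" for x
    unfolding cscale_def const_def single_one by (rule mult_1_left)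
qed

definition jacobian_ideal :: "quat_poly \<Rightarrow> quat_poly set" where
  "jacobian_ideal f = ideal.span (range (\<lambda>i. partial i f))"

text \<open>
  \<open>basis_mod V W B\<close>: the classes of the elements of \<open>B\<close> are pairwise distinct and form a
  finite basis of the complex vector space \<open>V / W\<close>, for subspaces \<open>W\<close> of \<open>V\<close>.
\<close>

definition basis_mod :: "quat_poly set \<Rightarrow> quat_poly set \<Rightarrow> quat_poly set \<Rightarrow> bool" where
  "basis_mod V W B \<longleftrightarrow>
     finite B \<and> B \<subseteq> V \<and>
     (\<forall>c. (\<Sum>b\<in>B. cscale (c b) b) \<in> W \<longrightarrow> (\<forall>b\<in>B. c b = 0)) \<and>
     (\<forall>v\<in>V. \<exists>c. v - (\<Sum>b\<in>B. cscale (c b) b) \<in> W)"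

definition quotient_dim :: "quat_poly set \<Rightarrow> quat_poly set \<Rightarrow> nat" where
  "quotient_dim V W = (THE n. \<exists>B. basis_mod V W B \<and> card B = n)"

text \<open>The Hilbert function of \<open>M(f) = S / J\<^sub>f\<close>; its degree \<open>k\<close> part is \<open>S\<^sub>k / (J\<^sub>f \<inter> S\<^sub>k)\<close>.\<close>

definition hilbert_fun :: "quat_poly \<Rightarrow> nat \<Rightarrow> nat" where
  "hilbert_fun f k = quotient_dim (graded_piece k) (jacobian_ideal f \<inter> graded_piece k)"

definition hilbert_poly :: "quat_poly \<Rightarrow> real poly" where
  "hilbert_poly f =
     (THE P. \<forall>\<^sub>F k in sequentially. real (hilbert_fun f k) = poly P (real k))"

text \<open>Syzygies \<open>(a\<^sub>0, a\<^sub>1, a\<^sub>2, a\<^sub>3)\<close> of the partial derivatives, and the Koszul ones among them.\<close>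

definition AR :: "quat_poly \<Rightarrow> (quat_poly ^ 4) set" where
  "AR f = {a. (\<Sum>i\<in>UNIV. a $ i * partial i f) = 0}"

definition KR :: "quat_poly \<Rightarrow> (quat_poly ^ 4) set" where
  "KR f = S4.span {axis i (partial j f) - axis j (partial i f) | i j. True}"

definition homogeneous_vec :: "nat \<Rightarrow> quat_poly ^ 4 \<Rightarrow> bool" where
  "homogeneous_vec q a \<longleftrightarrow> (\<forall>i. homogeneous q (a $ i))"

text \<open>
  \<open>AR(f)\<close> is a free graded module with a homogeneous basis in degrees \<open>d\<^sub>1 \<le> d\<^sub>2 \<le> d\<^sub>3\<close>.
  Since \<open>AR(f)\<close> is the kernel of \<open>S(-(d-1))\<^sup>4 \<rightarrow> S\<close>, this is the same as a resolution
  \<open>0 \<rightarrow> \<Oplus>\<^sub>j S(-(d-1)-d\<^sub>j) \<rightarrow> S(-(d-1))\<^sup>4 \<rightarrow> S\<close> of \<open>M(f)\<close>.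
\<close>

definition free_with_exponents :: "quat_poly \<Rightarrow> nat \<Rightarrow> nat \<Rightarrow> nat \<Rightarrow> bool" where
  "free_with_exponents f d1 d2 d3 \<longleftrightarrow>
     d1 \<le> d2 \<and> d2 \<le> d3 \<and>
     (\<exists>r1 r2 r3. distinct [r1, r2, r3] \<and>
        homogeneous_vec d1 r1 \<and> homogeneous_vec d2 r2 \<and> homogeneous_vec d3 r3 \<and>
        \<not> S4.dependent {r1, r2, r3} \<and> S4.span {r1, r2, r3} = AR f)"

definition st :: "quat_poly \<Rightarrow> nat" where
  "st f = (LEAST q. \<forall>k\<ge>q. real (hilbert_fun f k) = poly (hilbert_poly f) (real k))"

text \<open>
  The smooth comparison polynomial \<open>fs\<close> is an explicit argument; statements about \<open>ct\<close>
  quantify over every smooth \<open>fs\<close> of the same degree as \<open>f\<close>.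
\<close>

definition ct :: "quat_poly \<Rightarrow> quat_poly \<Rightarrow> nat" where
  "ct f fs = (GREATEST q. \<forall>k\<le>q. hilbert_fun f k = hilbert_fun fs k)"

text \<open>
  \<open>AR(f)\<^sub>q / KR(f)\<^sub>q\<close>, which is the Koszul cohomology \<open>H\<^sup>3(K\<^sup>*(f))\<^sub>q\<^sub>+\<^sub>3\<close>, is nonzero
  iff some syzygy of degree \<open>q\<close> is not in \<open>KR(f)\<close>.
\<close>

definition mdr :: "quat_poly \<Rightarrow> nat" where
  "mdr f = (LEAST q. \<exists>a\<in>AR f. homogeneous_vec q a \<and> a \<notin> KR f)"

end

theory Submission
  imports
    Defs
    "HOL-Computational_Algebra.Polynomial_Factorial"
    "HOL-Computational_Algebra.Field_as_Ring"
    "HOL-Computational_Algebra.Fundamental_Theorem_Algebra"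
begin

text \<open>
  Put \<open>D = d - 1\<close>, let \<open>f\<^sub>i\<close> be the partial derivatives and \<open>J\<close> the ideal they generate.
  Rank-nullity for \<open>a \<mapsto> \<Sum>\<^sub>i a\<^sub>i f\<^sub>i\<close>, from quadruples of degree \<open>q\<close> onto \<open>J\<close> in degree \<open>q + D\<close>
  with kernel \<open>AR(f)\<^sub>q\<close>, together with the monomial multiples of the basis of \<open>AR(f)\<close>, gives
  \<open>H(k) = N(k) - 4 N(k - D) + \<Sum>\<^sub>j N(k - D - d\<^sub>j)\<close>, where \<open>N(n)\<close> is the number of monomials of
  degree \<open>n\<close> (\<open>hilbert_fun_plus\<close>, \<open>dim_syzygies_free\<close>, \<open>hilbert_fun_free\<close>). The function \<open>N\<close>
  agrees with the polynomial \<open>(n + 1)(n + 2)(n + 3) / 6\<close> for \<open>n \<ge> -3\<close> and exceeds it by \<open>1\<close> at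
  \<open>n = -4\<close>. Hence \<open>H\<close> is given by the alternating sum of cubics, the Hilbert polynomial, from
  \<open>k = D + d\<^sub>3 - 3\<close> on. One step below, precisely the terms with \<open>d\<^sub>j = d\<^sub>3\<close> are off, all by \<open>1\<close>
  with the same sign, so this is \<open>st\<close>.

  The degree equation \<open>d\<^sub>1 + d\<^sub>2 + d\<^sub>3 = D\<close> is two inequalities. The coefficient of \<open>k\<^sup>2\<close> in that
  sum is \<open>(D - d\<^sub>1 - d\<^sub>2 - d\<^sub>3) / 2\<close>, and it cannot be negative since \<open>H \<ge> 0\<close>. Conversely, the
  signed maximal minors \<open>\<Delta>\<^sub>i\<close> of the basis are proportional to the \<open>f\<^sub>i\<close>, so that Euler's formula
  gives \<open>d f \<Delta>\<^sub>i = \<delta> f\<^sub>i\<close> with \<open>\<delta> = \<Sum>\<^sub>j x\<^sub>j \<Delta>\<^sub>j\<close>, the determinant that also occurs in Saito's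
  criterion. Thus \<open>f\<close> divides every \<open>\<delta> f\<^sub>i\<close>; as \<open>f\<close> is squarefree and \<open>S\<close> is factorial, \<open>f\<close>
  divides \<open>\<delta>\<close> (\<open>squarefree_dvd\<close>), a nonzero form of degree \<open>1 + d\<^sub>1 + d\<^sub>2 + d\<^sub>3\<close>.

  Koszul relations start in degree \<open>D\<close>, which exceeds \<open>d\<^sub>1\<close>, and below \<open>d\<^sub>1\<close> there are no
  syzygies; so \<open>mdr = d\<^sub>1\<close>. For \<open>ct\<close>, the Hilbert functions of \<open>f\<close> and of a smooth \<open>f\<^sub>s\<close> agree
  until the first syzygy of \<open>f\<close> contributes, in degree \<open>D + d\<^sub>1\<close>, provided \<open>f\<^sub>s\<close> has no syzygies
  in degrees below \<open>D\<close>. This is where smoothness enters: the partial derivatives of \<open>f\<^sub>s\<close> have no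
  common zero but the origin, hence by the Nullstellensatz their ideal contains a power of each variable
  (\<open>variable_power_in_ideal\<close>). Powers of the variables form a regular sequence, and
  this forces the first Koszul homology of the derivatives to vanish (\<open>koszul_unwinding\<close>). So each
  component of a syzygy lies in an ideal generated in degree \<open>D\<close>.
\<close>

section \<open>Homogeneous components\<close>

text \<open>
  The index set of a sum over the support changes when polynomials are added; this is harmless when
  the summand is additive in the coefficient.
\<close>

lemma sum_keys_additive:
  fixes g :: "'a \<Rightarrow> 'b::comm_monoid_add \<Rightarrow> 'c::comm_monoid_add"
  assumes "\<And>m. g m 0 = 0" and "\<And>m a b. g m (a + b) = g m a + g m b"
  shows "(\<Sum>m\<in>keys (p + q). g m (lookup (p + q) m)) =
    (\<Sum>m\<in>keys p. g m (lookup p m)) + (\<Sum>m\<in>keys q. g m (lookup q m))"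
  using setsum_keys_plus_distrib[of g p q] assms by (simp add: Poly_Mapping.lookup_add)

lemma sum_of_terms:
  fixes p :: "'a \<Rightarrow>\<^sub>0 'b::comm_monoid_add"
  shows "p = (\<Sum>m\<in>keys p. Poly_Mapping.single m (lookup p m))"
  by (rule poly_mapping_eqI)
    (auto simp: lookup_sum lookup_single when_def sum.delta' in_keys_iff)

text \<open>
  Identities that are additive in a polynomial need only be checked on monomials; two nested uses
  settle bilinear ones.
\<close>

lemma additive_induct [case_names zero single add]:
  fixes p :: "'a \<Rightarrow>\<^sub>0 'b::comm_monoid_add"
  assumes "P 0" and "\<And>m c. P (Poly_Mapping.single m c)" and "\<And>p q. P p \<Longrightarrow> P q \<Longrightarrow> P (p + q)"
  shows "P p"
proof -
  have "P (\<Sum>m\<in>A. Poly_Mapping.single m (lookup p m))" if "finite A" for A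
    using that by (induction A rule: finite_induct) (auto intro: assms)
  from this[of "keys p"] show ?thesis by (simp flip: sum_of_terms)
qed

definition homog_part :: "nat \<Rightarrow> quat_poly \<Rightarrow> quat_poly" where
  "homog_part k p = Poly_Mapping.mapp (\<lambda>m c. c when mon_degree m = k) p"

lemma lookup_homog_part: "lookup (homog_part k p) m = (lookup p m when mon_degree m = k)"
  by (auto simp: homog_part_def lookup_mapp when_def in_keys_iff)

lemma mon_degree_add: "mon_degree (m + n) = mon_degree m + mon_degree n"
  by (simp add: mon_degree_def Poly_Mapping.lookup_add sum.distrib)

lemma mon_degree_0 [simp]: "mon_degree 0 = 0"
  by (simp add: mon_degree_def)

lemma mon_degree_single [simp]: "mon_degree (Poly_Mapping.single i n) = n"
  by (simp add: mon_degree_def lookup_single when_def sum.delta)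

lemma homog_part_0 [simp]: "homog_part k 0 = 0"
  by (rule poly_mapping_eqI) (simp add: lookup_homog_part)

lemma homog_part_add: "homog_part k (p + q) = homog_part k p + homog_part k q"
  by (rule poly_mapping_eqI) (simp add: lookup_homog_part Poly_Mapping.lookup_add when_def)

lemma homog_part_diff: "homog_part k (p - q) = homog_part k p - homog_part k q"
  by (rule poly_mapping_eqI) (simp add: lookup_homog_part lookup_minus when_def)

lemma homog_part_sum: "homog_part k (sum g A) = (\<Sum>a\<in>A. homog_part k (g a))"
  by (induction A rule: infinite_finite_induct) (auto simp: homog_part_add)

lemma homog_part_single:
  "homog_part k (Poly_Mapping.single m c) = (Poly_Mapping.single m c when mon_degree m = k)"
  by (rule poly_mapping_eqI) (auto simp: lookup_homog_part lookup_single when_def)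

lemma homog_part_mult: "homog_part k (p * q) = (\<Sum>i\<le>k. homog_part i p * homog_part (k - i) q)"
proof (induction p rule: additive_induct)
  case (single m c)
  show ?case
  proof (induction q rule: additive_induct)
    case (single n c')
    have "(\<Sum>i\<le>k. homog_part i (Poly_Mapping.single m c) * homog_part (k - i) (Poly_Mapping.single n c'))
      = (\<Sum>i\<le>k. if i = mon_degree m then (Poly_Mapping.single (m + n) (c * c') when mon_degree n = k - i) else 0)"
      by (intro sum.cong refl) (auto simp: homog_part_single mult_single when_def)
    also have "\<dots> = homog_part k (Poly_Mapping.single (m + n) (c * c'))"
      by (auto simp: homog_part_single mon_degree_add when_def)
    finally show ?case by (simp add: mult_single)
  qed (simp_all add: homog_part_add distrib_left sum.distrib)
qed (simp_all add: homog_part_add distrib_right sum.distrib)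

lemma homogeneous_homog_part: "homogeneous k (homog_part k p)"
  by (auto simp: homogeneous_def in_keys_iff lookup_homog_part when_def split: if_splits)

lemma homog_part_homogeneous: "homogeneous e p \<Longrightarrow> homog_part k p = (p when e = k)"
  by (rule poly_mapping_eqI) (auto simp: homogeneous_def in_keys_iff lookup_homog_part when_def)

lemma homogeneous_iff_homog_part: "homogeneous k p \<longleftrightarrow> homog_part k p = p"
  using homogeneous_homog_part[of k p] homog_part_homogeneous[of k p k] by auto

lemma homogeneous_0 [simp]: "homogeneous k 0"
  by (simp add: homogeneous_def)

lemma homogeneous_add: "homogeneous k p \<Longrightarrow> homogeneous k q \<Longrightarrow> homogeneous k (p + q)"
  by (simp add: homogeneous_iff_homog_part homog_part_add)

lemma homogeneous_diff: "homogeneous k p \<Longrightarrow> homogeneous k q \<Longrightarrow> homogeneous k (p - q)"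
  by (simp add: homogeneous_iff_homog_part homog_part_diff)

lemma homogeneous_sum: "(\<And>a. a \<in> A \<Longrightarrow> homogeneous k (g a)) \<Longrightarrow> homogeneous k (sum g A)"
  by (simp add: homogeneous_iff_homog_part homog_part_sum)

lemma homogeneous_single: "mon_degree m = k \<Longrightarrow> homogeneous k (Poly_Mapping.single m c)"
  by (simp add: homogeneous_def)

text \<open>
  Taking components commutes with multiplication by a form up to a shift of degree. This makes
  ideals and modules with homogeneous generators stable under taking components.
\<close>

lemma homog_part_mult_homogeneous:
  assumes "homogeneous e F"
  shows "homog_part k (p * F) = (if e \<le> k then homog_part (k - e) p * F else 0)"
proof -
  have "homog_part k (F * p) = (\<Sum>i\<le>k. if i = e then F * homog_part (k - e) p else 0)"
    unfolding homog_part_mult by (intro sum.cong refl) (auto simp: homog_part_homogeneous[OF assms] when_def)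
  then show ?thesis by (simp add: mult.commute)
qed

lemma homogeneous_mult:
  assumes "homogeneous k p" "homogeneous l q"
  shows "homogeneous (k + l) (p * q)"
  using assms homog_part_mult_homogeneous[OF assms(2), of "k + l" p] by (simp add: homogeneous_iff_homog_part)

lemma exists_homog_part: "p \<noteq> 0 \<Longrightarrow> \<exists>k. homog_part k p \<noteq> 0"
proof (rule ccontr)
  assume p: "p \<noteq> 0" and "\<nexists>k. homog_part k p \<noteq> 0"
  then have "lookup (homog_part (mon_degree m) p) m = 0" for m by simp
  then have "p = 0" by (intro poly_mapping_eqI) (simp add: lookup_homog_part)
  with p show False by simp
qed

lemma homog_part_bounded: "\<exists>n. \<forall>k>n. homog_part k p = 0"
proof -
  have fin: "finite (mon_degree ` keys p)" by simp
  have "homog_part k p = 0" if "k > Max (mon_degree ` keys p)" for k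
  proof (rule poly_mapping_eqI)
    fix m
    show "lookup (homog_part k p) m = lookup 0 m"
    proof (cases "m \<in> keys p")
      case True
      then have "mon_degree m < k" using le_less_trans[OF Max_ge[OF fin] that] by simp
      then show ?thesis by (simp add: lookup_homog_part)
    next
      case False
      then show ?thesis by (simp add: lookup_homog_part in_keys_iff)
    qed
  qed
  then show ?thesis by blast
qed

lemma exists_top_homog_part:
  assumes "p \<noteq> 0" obtains n where "homog_part n p \<noteq> 0" "\<And>k. k > n \<Longrightarrow> homog_part k p = 0"
proof -
  obtain k where k: "homog_part k p \<noteq> 0" using exists_homog_part assms by blast
  obtain b where b: "\<And>k. k > b \<Longrightarrow> homog_part k p = 0" using homog_part_bounded by blast
  define n where "n = (GREATEST k. homog_part k p \<noteq> 0)"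
  have bd: "\<And>k. homog_part k p \<noteq> 0 \<Longrightarrow> k \<le> b" using b by (meson not_le)
  have "homog_part n p \<noteq> 0" unfolding n_def by (rule GreatestI_nat[where P = "\<lambda>k. homog_part k p \<noteq> 0", OF k bd])
  moreover have "k \<le> n" if "homog_part k p \<noteq> 0" for k
    unfolding n_def by (rule Greatest_le_nat[where P = "\<lambda>k. homog_part k p \<noteq> 0", OF that bd])
  ultimately show thesis using that by (meson not_le)
qed

text \<open>
  Leading forms multiply; in a domain the product is nonzero, so total degrees add.
\<close>

lemma homog_part_top_mult:
  assumes "\<And>k. k > a \<Longrightarrow> homog_part k p = 0" "\<And>k. k > b \<Longrightarrow> homog_part k q = 0"
  shows "homog_part (a + b) (p * q) = homog_part a p * homog_part b q"
proof -
  have "homog_part (a + b) (p * q) = (\<Sum>i\<le>a + b. if i = a then homog_part a p * homog_part b q else 0)"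
    unfolding homog_part_mult
  proof (intro sum.cong refl)
    fix i assume "i \<in> {..a + b}"
    then show "homog_part i p * homog_part (a + b - i) q = (if i = a then homog_part a p * homog_part b q else 0)"
      using assms(1)[of i] assms(2)[of "a + b - i"] by (cases i a rule: linorder_cases) auto
  qed
  then show ?thesis by simp
qed

section \<open>Partial derivatives\<close>

lemma partial_single:
  "partial i (Poly_Mapping.single m c) =
     Poly_Mapping.single (m - Poly_Mapping.single i 1) (of_nat (lookup m i) * c)"
  by (simp add: partial_def)

lemma partial_0 [simp]: "partial i 0 = 0"
  by (simp add: partial_def)

lemma partial_add: "partial i (p + q) = partial i p + partial i q"
  unfolding partial_def
  by (rule sum_keys_additive[where
        g = "\<lambda>m c. Poly_Mapping.single (m - Poly_Mapping.single i 1) (of_nat (lookup m i) * c)"])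
    (simp_all add: distrib_left single_add)

lemma single_minus_unit_plus:
  assumes "lookup m i > 0"
  shows "m - Poly_Mapping.single i (1::nat) + Poly_Mapping.single i 1 = m"
  using assms by (intro poly_mapping_eqI) (auto simp: Poly_Mapping.lookup_add lookup_minus lookup_single when_def)

lemma lookup_partial:
  "lookup (partial i p) m = of_nat (lookup m i + 1) * lookup p (m + Poly_Mapping.single i 1)"
proof (induction p rule: additive_induct)
  case (single n c)
  show ?case
  proof (cases "lookup n i > 0")
    case True
    then have "n - Poly_Mapping.single i 1 = m \<longleftrightarrow> n = m + Poly_Mapping.single i 1"
      using single_minus_unit_plus[OF True] by auto
    then show ?thesis
      by (auto simp: partial_single lookup_single when_def Poly_Mapping.lookup_add)
  next
    case False
    then have "n \<noteq> m + Poly_Mapping.single i 1"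
      by (auto simp: Poly_Mapping.lookup_add)
    with False show ?thesis by (simp add: partial_single lookup_single when_def)
  qed
qed (simp_all add: partial_add Poly_Mapping.lookup_add distrib_left)

lemma partial_mult: "partial i (p * q) = partial i p * q + p * partial i q"
proof (induction p rule: additive_induct)
  case (single m c)
  show ?case
  proof (induction q rule: additive_induct)
    case (single n c')
    let ?e = "Poly_Mapping.single i (1::nat)"
    have a: "Poly_Mapping.single (m - ?e + n) (of_nat (lookup m i) * c * c')
        = Poly_Mapping.single (m + n - ?e) (of_nat (lookup m i) * c * c')"
    proof (cases "lookup m i > 0")
      case True
      then have "m - ?e + n = m + n - ?e"
        by (intro poly_mapping_eqI) (auto simp: Poly_Mapping.lookup_add lookup_minus lookup_single when_def)
      then show ?thesis by simp
    qed simp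
    have b: "Poly_Mapping.single (m + (n - ?e)) (c * (of_nat (lookup n i) * c'))
        = Poly_Mapping.single (m + n - ?e) (c * (of_nat (lookup n i) * c'))"
    proof (cases "lookup n i > 0")
      case True
      then have "m + (n - ?e) = m + n - ?e"
        by (intro poly_mapping_eqI) (auto simp: Poly_Mapping.lookup_add lookup_minus lookup_single when_def)
      then show ?thesis by simp
    qed simp
    have "partial i (Poly_Mapping.single m c * Poly_Mapping.single n c')
      = Poly_Mapping.single (m + n - ?e) (of_nat (lookup m i) * c * c' + c * (of_nat (lookup n i) * c'))"
      by (simp add: mult_single partial_single Poly_Mapping.lookup_add algebra_simps)
    then show ?case
      unfolding single_add a[symmetric] b[symmetric] by (simp add: partial_single mult_single)
  qed (simp_all add: partial_add algebra_simps)
qed (simp_all add: partial_add algebra_simps)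

lemma homog_part_partial: "homog_part k (partial i p) = partial i (homog_part (Suc k) p)"
  by (rule poly_mapping_eqI) (simp add: lookup_homog_part lookup_partial mon_degree_add when_def)

lemma homogeneous_partial: "homogeneous d f \<Longrightarrow> homogeneous (d - 1) (partial i f)"
proof (cases d)
  case 0
  assume "homogeneous d f"
  then have "f = homog_part 0 f" by (simp add: 0 homogeneous_iff_homog_part)
  then have "lookup f (m + Poly_Mapping.single i 1) = 0" for m
    using lookup_homog_part[of 0 f "m + Poly_Mapping.single i 1"] by (simp add: mon_degree_add)
  then have "partial i f = 0" by (intro poly_mapping_eqI) (simp add: lookup_partial)
  then show ?thesis by simp
qed (simp add: homogeneous_iff_homog_part homog_part_partial)

text \<open>
  In characteristic zero a monomial that involves some variable survives the derivative
  with respect to it.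
\<close>

lemma const_of_partials_0:
  assumes "\<And>i. partial i g = 0"
  shows "g = const (lookup g 0)"
proof (rule poly_mapping_eqI)
  fix m
  show "lookup g m = lookup (const (lookup g 0)) m"
  proof (cases "m = 0")
    case True then show ?thesis by (simp add: const_def)
  next
    case False
    then obtain i where "lookup m i > 0"
      by (auto simp: poly_mapping_eq_iff fun_eq_iff)
    then have "lookup g m * of_nat (lookup m i) = lookup (partial i g) (m - Poly_Mapping.single i 1)"
      by (simp only: lookup_partial single_minus_unit_plus) (simp add: lookup_minus)
    with assms \<open>lookup m i > 0\<close> have "lookup g m = 0" by simp
    with False show ?thesis by (simp add: const_def lookup_single)
  qed
qed

lemma single_sum: "Poly_Mapping.single m (sum g A) = (\<Sum>a\<in>A. Poly_Mapping.single m (g a))"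
  by (induction A rule: infinite_finite_induct) (auto simp: single_add)

lemma euler:
  assumes "homogeneous d f"
  shows "(\<Sum>i\<in>UNIV. variable i * partial i f) = of_nat d * f"
proof -
  have term_eq: "variable i * Poly_Mapping.single (m - Poly_Mapping.single i 1) (of_nat (lookup m i) * c)
      = Poly_Mapping.single m (of_nat (lookup m i) * c)" for i m c
    using single_minus_unit_plus[of m i]
    by (cases "lookup m i > 0") (simp_all add: variable_def mult_single add.commute)
  have "(\<Sum>i\<in>UNIV. variable i * partial i f)
      = (\<Sum>i\<in>UNIV. \<Sum>m\<in>keys f. Poly_Mapping.single m (of_nat (lookup m i) * lookup f m))"
    unfolding partial_def sum_distrib_left by (simp only: term_eq)
  also have "\<dots> = (\<Sum>m\<in>keys f. Poly_Mapping.single m (of_nat (mon_degree m) * lookup f m))"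
    by (subst sum.swap) (simp add: mon_degree_def sum_distrib_right single_sum)
  also have "\<dots> = (\<Sum>m\<in>keys f. of_nat d * Poly_Mapping.single m (lookup f m))"
    using assms by (intro sum.cong refl) (simp add: homogeneous_def mult_single flip: single_of_nat)
  also have "\<dots> = of_nat d * f"
    by (simp flip: sum_distrib_left sum_of_terms)
  finally show ?thesis .
qed

section \<open>Unique factorization\<close>

text \<open>
  The isomorphism of \<open>S\<close> with iterated univariate polynomials over \<open>\<complex>\<close>, which are known to form
  a factorial ring.
\<close>

definition nest :: "quat_poly \<Rightarrow> complex poly poly poly poly" where
  "nest p = (\<Sum>m\<in>keys p. monom (monom (monom (monom (lookup p m) (lookup m 1)) (lookup m 2)) (lookup m 3)) (lookup m 4))"

lemma nest_0 [simp]: "nest 0 = 0"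
  by (simp add: nest_def)

lemma nest_add: "nest (p + q) = nest p + nest q"
  unfolding nest_def
  by (rule sum_keys_additive[where
        g = "\<lambda>m c. monom (monom (monom (monom c (lookup m 1)) (lookup m 2)) (lookup m 3)) (lookup m 4)"])
    (simp_all add: add_monom)

lemma nest_single:
  "nest (Poly_Mapping.single m c) =
     monom (monom (monom (monom c (lookup m 1)) (lookup m 2)) (lookup m 3)) (lookup m 4)"
  by (simp add: nest_def)

lemma nest_mult: "nest (p * q) = nest p * nest q"
proof (induction p rule: additive_induct)
  case (single m c)
  show ?case
    by (induction q rule: additive_induct)
      (simp_all add: mult_single nest_single mult_monom Poly_Mapping.lookup_add nest_add distrib_left)
qed (simp_all add: nest_add distrib_right)

lemma nest_1 [simp]: "nest 1 = 1"
  by (simp add: nest_single monom_0 one_pCons flip: single_one)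

text \<open>
  Reading off the nested coefficients inverts \<open>nest\<close>, so it is injective.
\<close>

lemma coeff_nest:
  "coeff (coeff (coeff (coeff (nest p) (lookup m 4)) (lookup m 3)) (lookup m 2)) (lookup m 1) = lookup p m"
proof (induction p rule: additive_induct)
  case (single n c)
  have "n = m \<longleftrightarrow> lookup n 1 = lookup m 1 \<and> lookup n 2 = lookup m 2 \<and> lookup n 3 = lookup m 3 \<and> lookup n 4 = lookup m 4"
    unfolding poly_mapping_eq_iff fun_eq_iff forall_4 ..
  then show ?case by (auto simp: nest_single lookup_single when_def)
qed (simp_all add: nest_add Poly_Mapping.lookup_add)

lemma nest_inject: "nest p = nest q \<longleftrightarrow> p = q"
  by (auto intro: poly_mapping_eqI simp flip: coeff_nest)

text \<open>
  Used once per variable to reduce surjectivity of \<open>nest\<close> to nested monomials.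
\<close>

lemma poly_in_additive_set:
  fixes P :: "'a::comm_monoid_add poly"
  assumes "0 \<in> R" "\<And>p q. p \<in> R \<Longrightarrow> q \<in> R \<Longrightarrow> p + q \<in> R" "\<And>c i. monom c i \<in> R"
  shows "P \<in> R"
proof -
  have "(\<Sum>i\<in>A. monom (coeff P i) i) \<in> R" for A
    by (induction A rule: infinite_finite_induct) (auto intro: assms)
  from this[of "{..degree P}"] show ?thesis by (simp add: poly_as_sum_of_monoms)
qed

lemma surj_nest: "P \<in> range nest"
proof -
  have zero: "0 \<in> range nest" by (rule range_eqI[of _ _ 0]) simp
  have add: "p + q \<in> range nest" if "p \<in> range nest" "q \<in> range nest" for p q
    using that by (auto simp flip: nest_add)
  have monom: "monom (monom (monom (monom c i) j) k) l \<in> range nest" for c i j k l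
  proof -
    let ?m = "Poly_Mapping.single (1::4) i + Poly_Mapping.single 2 j + Poly_Mapping.single 3 k + Poly_Mapping.single 4 l"
    have "lookup ?m 1 = i" "lookup ?m 2 = j" "lookup ?m 3 = k" "lookup ?m 4 = l"
      by (simp_all add: Poly_Mapping.lookup_add lookup_single)
    then have "nest (Poly_Mapping.single ?m c) = monom (monom (monom (monom c i) j) k) l"
      unfolding nest_single by simp
    then show ?thesis by (metis rangeI)
  qed
  have 3: "Q \<in> {Q. monom (monom (monom Q j) k) l \<in> range nest}" for Q j k l
    by (rule poly_in_additive_set) (auto simp: zero add monom simp flip: add_monom)
  have 2: "Q \<in> {Q. monom (monom Q k) l \<in> range nest}" for Q k l
    by (rule poly_in_additive_set) (auto simp: zero add 3[simplified] simp flip: add_monom)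
  have 1: "Q \<in> {Q. monom Q l \<in> range nest}" for Q l
    by (rule poly_in_additive_set) (auto simp: zero add 2[simplified] simp flip: add_monom)
  show ?thesis
    by (rule poly_in_additive_set) (auto simp: zero add 1[simplified])
qed

lemma nest_dvd_iff: "nest p dvd nest q \<longleftrightarrow> p dvd q"
proof
  assume "nest p dvd nest q"
  then obtain R where R: "nest q = nest p * R" by (elim dvdE)
  obtain r where "R = nest r" using surj_nest[of R] by (elim rangeE)
  with R have "q = p * r" by (simp add: nest_inject flip: nest_mult)
  then show "p dvd q" by simp
qed (auto simp: nest_mult)

text \<open>
  A derivative has smaller total degree than the polynomial, so only \<open>0\<close> can be a multiple.
\<close>

lemma dvd_partial_imp_0:
  assumes "u dvd partial i u"
  shows "partial i u = 0"
proof (rule ccontr)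
  assume nz: "partial i u \<noteq> 0"
  obtain h where h: "partial i u = u * h" using assms by (elim dvdE)
  with nz have "u \<noteq> 0" "h \<noteq> 0" by auto
  obtain a where a: "homog_part a u \<noteq> 0" "\<And>k. k > a \<Longrightarrow> homog_part k u = 0"
    using exists_top_homog_part[OF \<open>u \<noteq> 0\<close>] by blast
  obtain b where b: "homog_part b h \<noteq> 0" "\<And>k. k > b \<Longrightarrow> homog_part k h = 0"
    using exists_top_homog_part[OF \<open>h \<noteq> 0\<close>] by blast
  have "homog_part (a + b) (partial i u) = homog_part a u * homog_part b h"
    unfolding h by (rule homog_part_top_mult) (use a b in auto)
  moreover have "homog_part (a + b) (partial i u) = 0"
    by (simp add: homog_part_partial a(2))
  ultimately show False using a(1) b(1) by simp
qed

text \<open>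
  A prime factor \<open>u\<close> of \<open>f = u v\<close> cannot divide all partial derivatives of \<open>f\<close>: by the product
  rule it would divide \<open>(\<partial>\<^sub>i u) v\<close>, hence \<open>\<partial>\<^sub>i u\<close> because \<open>u\<close> does not divide \<open>v\<close>, so
  \<open>\<partial>\<^sub>i u = 0\<close> for all \<open>i\<close> and \<open>u\<close> would be constant. Therefore \<open>u\<close> divides \<open>g\<close>, and every prime
  factor of \<open>f\<close> has multiplicity one.
\<close>

lemma squarefree_dvd:
  assumes sf: "squarefree f" and dvd: "\<And>i. f dvd g * partial i f"
  shows "f dvd g"
proof (cases "g = 0")
  case False
  have f0: "f \<noteq> 0" using sf by auto
  have nz: "nest f \<noteq> 0" "nest g \<noteq> 0" using f0 False nest_inject[of _ 0] by auto
  have sfn: "squarefree (nest f)"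
  proof (rule squarefreeI)
    fix Y assume Y: "Y ^ 2 dvd nest f"
    obtain y where y: "Y = nest y" using surj_nest[of Y] by (elim rangeE)
    have "nest (y ^ 2) dvd nest f" using Y by (simp add: y nest_mult power2_eq_square)
    then have "y dvd 1" using sf squarefreeD unfolding nest_dvd_iff by blast
    then show "Y dvd 1" using nest_dvd_iff[of y 1] by (simp add: y)
  qed
  have "multiplicity P (nest f) \<le> multiplicity P (nest g)" if P: "prime P" for P
  proof (cases "P dvd nest f")
    case True
    obtain u where u: "P = nest u" using surj_nest[of P] by (elim rangeE)
    have "u dvd f" using True by (simp add: u nest_dvd_iff)
    then obtain v where v: "f = u * v" by (elim dvdE)
    have pr: "u dvd a * b \<Longrightarrow> u dvd a \<or> u dvd b" for a b
      using P prime_dvd_mult_iff[of P "nest a" "nest b"] by (simp add: u nest_dvd_iff flip: nest_mult)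
    have nu: "\<not> u dvd 1" using P nest_dvd_iff[of u 1] by (auto simp: u)
    have "\<exists>i. \<not> u dvd partial i f"
    proof (rule ccontr)
      assume "\<nexists>i. \<not> u dvd partial i f"
      then have "u dvd partial i u * v" for i
        using dvd_diff[of u "partial i f" "u * partial i v"] by (auto simp: v partial_mult)
      moreover have "\<not> u dvd v"
      proof
        assume "u dvd v"
        then have "u ^ 2 dvd f" by (simp add: v power2_eq_square mult_dvd_mono)
        with sf nu show False using squarefreeD by blast
      qed
      ultimately have "u dvd partial i u" for i using pr by blast
      then have "partial i u = 0" for i by (rule dvd_partial_imp_0)
      then obtain c where c: "u = const c" using const_of_partials_0 by blast
      then have "c \<noteq> 0" using f0 v by (auto simp: const_def)
      then have "1 = u * const (inverse c)"
        unfolding c by (simp flip: const_mult) (simp add: const_def)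
      then have "u dvd 1" by (rule dvdI)
      with nu show False ..
    qed
    then obtain i where "\<not> u dvd partial i f" ..
    moreover have "u dvd g * partial i f" using \<open>u dvd f\<close> dvd by (rule dvd_trans)
    ultimately have "P dvd nest g" using pr by (auto simp: u nest_dvd_iff)
    then have "multiplicity P (nest g) \<ge> 1"
      using P nz by (intro multiplicity_geI) auto
    moreover have "multiplicity P (nest f) \<le> 1"
      using sfn nz P by (simp add: squarefree_factorial_semiring'')
    ultimately show ?thesis by simp
  qed (simp add: not_dvd_imp_multiplicity_0)
  then have "nest f dvd nest g"
    using nz by (intro multiplicity_le_imp_dvd) auto
  then show ?thesis by (simp add: nest_dvd_iff)
qed simp

section \<open>Maximal minors of three syzygies\<close>

definition minor :: "'a::comm_ring_1 ^ 'n \<Rightarrow> 'a ^ 'n \<Rightarrow> 'a ^ 'n \<Rightarrow> 'n \<Rightarrow> 'n \<Rightarrow> 'n \<Rightarrow> 'a" where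
  "minor a b c i j k =
     a $ i * (b $ j * c $ k - b $ k * c $ j) - b $ i * (a $ j * c $ k - a $ k * c $ j)
     + c $ i * (a $ j * b $ k - a $ k * b $ j)"

lemma minor_same [simp]: "minor a b c i i k = 0" "minor a b c i k k = 0" "minor a b c i k i = 0"
  by (simp_all add: minor_def algebra_simps)

lemma minor_permute_0:
  assumes "minor a b c i j k = 0"
  shows "minor a b c i k j = 0" "minor a b c j i k = 0" "minor a b c j k i = 0"
    "minor a b c k i j = 0" "minor a b c k j i = 0"
proof -
  have "minor a b c i k j = - minor a b c i j k" "minor a b c j i k = - minor a b c i j k"
    "minor a b c j k i = minor a b c i j k" "minor a b c k i j = minor a b c i j k"
    "minor a b c k j i = - minor a b c i j k"
    by (simp_all add: minor_def algebra_simps)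
  with assms show "minor a b c i k j = 0" "minor a b c j i k = 0" "minor a b c j k i = 0"
    "minor a b c k i j = 0" "minor a b c k j i = 0" by simp_all
qed

text \<open>
  Expanding the minor along its first column turns the sum into a combination of the three
  given relations.
\<close>

lemma minors_orthogonal:
  assumes "(\<Sum>i\<in>UNIV. a $ i * F i) = 0" "(\<Sum>i\<in>UNIV. b $ i * F i) = 0" "(\<Sum>i\<in>UNIV. c $ i * F i) = 0"
  shows "(\<Sum>i\<in>UNIV. F i * minor a b c i j k) = 0"
proof -
  have "(\<Sum>i\<in>UNIV. F i * minor a b c i j k)
      = (\<Sum>i\<in>UNIV. a $ i * F i) * (b $ j * c $ k - b $ k * c $ j)
      - (\<Sum>i\<in>UNIV. b $ i * F i) * (a $ j * c $ k - a $ k * c $ j)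
      + (\<Sum>i\<in>UNIV. c $ i * F i) * (a $ j * b $ k - a $ k * b $ j)"
    unfolding sum_distrib_right sum.distrib[symmetric] sum_subtractf[symmetric]
    by (intro sum.cong refl) (simp add: minor_def algebra_simps)
  then show ?thesis using assms by simp
qed

definition signed_minor :: "'a::comm_ring_1 ^ 4 \<Rightarrow> 'a ^ 4 \<Rightarrow> 'a ^ 4 \<Rightarrow> 4 \<Rightarrow> 'a" where
  "signed_minor a b c i =
     (if i = 1 then minor a b c 2 3 4 else if i = 2 then - minor a b c 1 3 4
      else if i = 3 then minor a b c 1 2 4 else - minor a b c 1 2 3)"

text \<open>
  In rank three the vector of maximal minors and \<open>F\<close> span the same line, both being orthogonal
  to \<open>a\<close>, \<open>b\<close>, \<open>c\<close>. Over a ring the proportionality follows by applying orthogonality to the minors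
  with two fixed columns: only two summands remain.
\<close>

lemma signed_minors_proportional:
  assumes "(\<Sum>i\<in>UNIV. a $ i * F i) = 0" "(\<Sum>i\<in>UNIV. b $ i * F i) = 0" "(\<Sum>i\<in>UNIV. c $ i * F i) = 0"
  shows "signed_minor a b c i * F j = signed_minor a b c j * F i"
proof -
  have o: "F 1 * minor a b c 1 j k + F 2 * minor a b c 2 j k + F 3 * minor a b c 3 j k
      + F 4 * minor a b c 4 j k = 0" for j k
    using minors_orthogonal[OF assms, of j k] by (simp add: sum_4)
  have p: "minor a b c 3 1 2 = minor a b c 1 2 3" "minor a b c 4 1 2 = minor a b c 1 2 4"
    "minor a b c 2 1 3 = - minor a b c 1 2 3" "minor a b c 4 1 3 = minor a b c 1 3 4"
    "minor a b c 2 1 4 = - minor a b c 1 2 4" "minor a b c 3 1 4 = - minor a b c 1 3 4"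
    "minor a b c 4 2 3 = minor a b c 2 3 4" "minor a b c 3 2 4 = - minor a b c 2 3 4"
    by (simp_all add: minor_def algebra_simps)
  have e: "F 2 * minor a b c 1 2 4 = - (F 3 * minor a b c 1 3 4)"
    using o[of 1 4] by (simp add: p eq_neg_iff_add_eq_0 add_eq_0_iff)
  have "\<forall>i j. signed_minor a b c i * F j = signed_minor a b c j * F i"
    unfolding forall_4
    using o[of 1 2] o[of 1 3] e o[of 2 3] o[of 2 4] o[of 3 4]
    by (auto simp: signed_minor_def p mult.commute add_eq_0_iff)
  then show ?thesis by blast
qed

text \<open>
  If some minor of size two of \<open>a\<close>, \<open>b\<close> is nonzero, expanding the vanishing minors of size three along their
  last column gives a relation in which it is the coefficient of \<open>c\<close>. Otherwise \<open>a\<close> and \<open>b\<close> are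
  proportional.
\<close>

lemma dependent_if_minors_0:
  fixes a b c :: "'a::idom ^ 4"
  assumes "\<And>i. signed_minor a b c i = 0"
  shows "\<exists>p q r. (p \<noteq> 0 \<or> q \<noteq> 0 \<or> r \<noteq> 0) \<and> p *s a + q *s b + r *s c = 0"
proof -
  have "minor a b c 2 3 4 = 0" "minor a b c 1 3 4 = 0" "minor a b c 1 2 4 = 0" "minor a b c 1 2 3 = 0"
    using assms[of 1] assms[of 2] assms[of 3] assms[of 4] by (simp_all add: signed_minor_def)
  note z = this this[THEN minor_permute_0(1)] this[THEN minor_permute_0(2)] this[THEN minor_permute_0(3)]
    this[THEN minor_permute_0(4)] this[THEN minor_permute_0(5)]
  have m0: "\<forall>i j k. minor a b c i j k = 0"
    unfolding forall_4 by (simp add: z)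
  show ?thesis
  proof (cases "a = 0")
    case True
    then have "1 *s a + 0 *s b + 0 *s c = 0" by (simp add: vec_eq_iff)
    then show ?thesis using one_neq_zero by blast
  next
    case False
    then obtain l where l: "a $ l \<noteq> 0" by (auto simp: vec_eq_iff)
    show ?thesis
    proof (cases "\<exists>i j. a $ i * b $ j - a $ j * b $ i \<noteq> 0")
      case True
      then obtain i j where ij: "a $ i * b $ j - a $ j * b $ i \<noteq> 0" by blast
      have "(b $ i * c $ j - b $ j * c $ i) *s a + (a $ j * c $ i - a $ i * c $ j) *s b
          + (a $ i * b $ j - a $ j * b $ i) *s c = 0"
      proof (subst vec_eq_iff, intro allI)
        fix k
        show "((b $ i * c $ j - b $ j * c $ i) *s a + (a $ j * c $ i - a $ i * c $ j) *s b
          + (a $ i * b $ j - a $ j * b $ i) *s c) $ k = 0 $ k"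
          using m0[rule_format, of k i j] by (simp add: minor_def algebra_simps)
      qed
      with ij show ?thesis by blast
    next
      case False
      then have "(- (b $ l)) *s a + (a $ l) *s b + 0 *s c = 0"
        by (simp add: vec_eq_iff algebra_simps)
      with l show ?thesis by blast
    qed
  qed
qed

lemma homogeneous_uminus: "homogeneous k p \<Longrightarrow> homogeneous k (- p)"
  using homogeneous_diff[of k 0 p] by simp

lemma homogeneous_signed_minor:
  assumes "homogeneous_vec d1 a" "homogeneous_vec d2 b" "homogeneous_vec d3 c"
  shows "homogeneous (d1 + d2 + d3) (signed_minor a b c i)"
proof -
  have "homogeneous (d1 + d2 + d3) (minor a b c i j k)" for i j k
  proof -
    have 1: "homogeneous (d1 + (d2 + d3)) (a $ i * (b $ j * c $ k - b $ k * c $ j))"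
      "homogeneous (d2 + (d1 + d3)) (b $ i * (a $ j * c $ k - a $ k * c $ j))"
      "homogeneous (d3 + (d1 + d2)) (c $ i * (a $ j * b $ k - a $ k * b $ j))"
      using assms unfolding homogeneous_vec_def
      by (auto intro!: homogeneous_mult homogeneous_diff)
    show ?thesis
      unfolding minor_def using 1
      by (intro homogeneous_add homogeneous_diff) (simp_all add: add_ac)
  qed
  then show ?thesis by (simp add: signed_minor_def homogeneous_uminus)
qed

lemma homogeneous_variable: "homogeneous 1 (variable i)"
  by (simp add: variable_def homogeneous_single)

text \<open>
  With \<open>\<delta> = \<Sum>\<^sub>j x\<^sub>j \<Delta>\<^sub>j\<close>, where \<open>\<Delta>\<^sub>j\<close> are the signed minors, proportionality and Euler's
  formula give \<open>d f \<Delta>\<^sub>i = \<delta> f\<^sub>i\<close>. Hence \<open>f\<close> divides \<open>\<delta>\<close>, which is nonzero of degree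
  \<open>1 + d\<^sub>1 + d\<^sub>2 + d\<^sub>3\<close>.
\<close>

lemma degree_le_sum_exponents:
  assumes f: "homogeneous d f" "squarefree f" "d \<ge> 1"
    and ar: "a \<in> AR f" "b \<in> AR f" "c \<in> AR f"
    and hom: "homogeneous_vec d1 a" "homogeneous_vec d2 b" "homogeneous_vec d3 c"
    and indep: "\<And>p q r. p *s a + q *s b + r *s c = 0 \<Longrightarrow> p = 0 \<and> q = 0 \<and> r = 0"
  shows "d \<le> 1 + (d1 + d2 + d3)"
proof -
  let ?D = "signed_minor a b c"
  define \<delta> where "\<delta> = (\<Sum>j\<in>UNIV. variable j * ?D j)"
  have f0: "f \<noteq> 0" using f(2) by auto
  have eq: "of_nat d * f * ?D i = \<delta> * partial i f" for i
  proof -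
    have "of_nat d * f * ?D i = (\<Sum>j\<in>UNIV. variable j * (?D i * partial j f))"
      unfolding euler[OF f(1), symmetric] sum_distrib_right
      by (intro sum.cong refl) (simp only: mult_ac)
    also have "\<dots> = (\<Sum>j\<in>UNIV. variable j * (?D j * partial i f))"
      using signed_minors_proportional[of a "\<lambda>i. partial i f" b c i] ar
      by (simp add: AR_def)
    also have "\<dots> = \<delta> * partial i f"
      unfolding \<delta>_def sum_distrib_right by (simp only: mult.assoc)
    finally show ?thesis .
  qed
  have "\<delta> \<noteq> 0"
  proof
    assume "\<delta> = 0"
    then have "?D i = 0" for i using eq[of i] f0 f(3) by simp
    then show False using dependent_if_minors_0[of a b c] indep by blast
  qed
  have "f dvd \<delta> * partial i f" for i
    unfolding eq[symmetric] by (rule dvd_mult2[OF dvd_triv_right])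
  then have "f dvd \<delta>" by (rule squarefree_dvd[OF f(2)])
  then obtain u where "\<delta> = f * u" by (rule dvdE)
  then have u: "\<delta> = u * f" by (simp only: mult.commute)
  have "homogeneous (1 + (d1 + d2 + d3)) \<delta>"
    unfolding \<delta>_def
    by (rule homogeneous_sum, rule homogeneous_mult[OF homogeneous_variable homogeneous_signed_minor[OF hom]])
  then have "homog_part (1 + (d1 + d2 + d3)) (u * f) \<noteq> 0"
    using \<open>\<delta> \<noteq> 0\<close> by (simp add: homogeneous_iff_homog_part u)
  then show ?thesis
    using homog_part_mult_homogeneous[OF f(1), of "1 + (d1 + d2 + d3)" u] by (auto split: if_splits)
qed

section \<open>Dimensions of quotients and images\<close>

lemma independent_disjoint_spans:
  fixes sc :: "'a::field \<Rightarrow> 'b::ab_group_add \<Rightarrow> 'b"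
  assumes "vector_space sc" "\<not> module.dependent sc C" "A \<subseteq> C"
    "x \<in> module.span sc A" "x \<in> module.span sc (C - A)"
  shows "x = 0"
proof -
  interpret vector_space sc by fact
  have "representation C x = representation A x" "representation C x = representation (C - A) x"
    using assms by (auto intro!: representation_extend)
  then have "representation C x b = 0" for b
    using representation_ne_zero[of A x b] representation_ne_zero[of "C - A" x b] by fastforce
  moreover have "x \<in> span C" using assms(3,4) span_mono by blast
  ultimately show "x = 0" using sum_nonzero_representation_eq[of C x] assms(2) by simp
qed

text \<open>
  The ambient space may have infinite dimension; only \<open>V\<close> is finitely generated.
\<close>

lemma rank_nullity:
  assumes lin: "Vector_Spaces.linear s1 s2 f" and sub: "module.subspace s1 V"
    and fin: "finite B" "V \<subseteq> module.span s1 B"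
  shows "vector_space.dim s1 V = vector_space.dim s1 {v\<in>V. f v = 0} + vector_space.dim s2 (f ` V)"
proof -
  interpret Vector_Spaces.linear s1 s2 f by fact
  let ?K = "{v\<in>V. f v = 0}"
  have subK: "vs1.subspace ?K"
    using sub by (auto simp: vs1.subspace_def add scale)
  obtain A where A: "A \<subseteq> ?K" "vs1.independent A" "?K \<subseteq> vs1.span A" "card A = vs1.dim ?K"
    using vs1.basis_exists by blast
  have "A \<subseteq> V" using A by auto
  then obtain C where C: "A \<subseteq> C" "C \<subseteq> V" "vs1.independent C" "V \<subseteq> vs1.span C"
    using vs1.maximal_independent_subset_extend A(2) by metis
  have finC: "finite C"
    using vs1.independent_span_bound[OF fin(1) C(3)] C(2) fin(2) by auto
  have dimV: "vs1.dim V = card C" using C vs1.basis_card_eq_dim by metis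
  have spV: "vs1.span C \<subseteq> V" using C(2) sub by (rule vs1.span_minimal)
  have inj: "inj_on f (vs1.span (C - A))"
  proof (rule inj_onI)
    fix x y assume xy: "x \<in> vs1.span (C - A)" "y \<in> vs1.span (C - A)" "f x = f y"
    then have m: "x - y \<in> vs1.span (C - A)" by (simp add: vs1.span_diff)
    then have "x - y \<in> V" using spV vs1.span_mono[of "C - A" C] by blast
    then have "x - y \<in> vs1.span A" using A(3) xy(3) by (auto simp: diff)
    then have "x - y = 0"
      using independent_disjoint_spans[OF vs1.vector_space_axioms C(3) C(1)] m by blast
    then show "x = y" by simp
  qed
  have ind: "vs2.independent (f ` (C - A))"
    using inj vs1.independent_mono[OF C(3), of "C - A"] by (intro independent_injective_image) auto
  have "f ` V \<subseteq> vs2.span (f ` (C - A))"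
  proof (intro image_subsetI)
    fix v assume "v \<in> V"
    then have "f v \<in> vs2.span (f ` C)" using C(4) span_image by blast
    moreover have "f ` C \<subseteq> insert 0 (f ` (C - A))" using A(1) by auto
    ultimately have "f v \<in> vs2.span (insert 0 (f ` (C - A)))" using vs2.span_mono by blast
    then show "f v \<in> vs2.span (f ` (C - A))" by simp
  qed
  moreover have "f ` (C - A) \<subseteq> f ` V" using C(2) by blast
  ultimately have "vs2.dim (f ` V) = card (f ` (C - A))"
    using ind vs2.basis_card_eq_dim[of "f ` (C - A)" "f ` V"] by simp
  also have "\<dots> = card (C - A)"
    using inj_on_subset[OF inj vs1.span_superset] by (rule card_image)
  also have "\<dots> = card C - card A" using C(1) finC by (meson card_Diff_subset finite_subset)
  finally show ?thesis using dimV A(4) card_mono[OF finC C(1)] by simp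
qed

text \<open>
  The form in which bases arise below: as families indexed by monomials, where injectivity of the
  indexing is a consequence of independence.
\<close>

lemma dim_parametrized:
  fixes sc :: "'a::field \<Rightarrow> 'b::ab_group_add \<Rightarrow> 'b"
  assumes vs: "vector_space sc" and fin: "finite X"
    and indep: "\<And>c. (\<Sum>x\<in>X. sc (c x) (b x)) = 0 \<Longrightarrow> \<forall>x\<in>X. c x = 0"
    and V: "\<And>v. v \<in> V \<longleftrightarrow> (\<exists>c. v = (\<Sum>x\<in>X. sc (c x) (b x)))"
  shows "vector_space.dim sc V = card X"
    and "V = module.span sc (b ` X)"
proof -
  interpret vector_space sc by fact
  have inj: "inj_on b X"
  proof (rule inj_onI, rule ccontr)
    fix x y assume xy: "x \<in> X" "y \<in> X" "b x = b y" "x \<noteq> y"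
    have "(\<Sum>z\<in>X. sc ((if z = x then 1 else 0) - (if z = y then 1 else 0)) (b z))
        = (\<Sum>z\<in>X. if z = x then b z else 0) - (\<Sum>z\<in>X. if z = y then b z else 0)"
      unfolding sum_subtractf[symmetric] by (intro sum.cong refl) (auto simp: scale_left_diff_distrib)
    also have "\<dots> = 0" using xy fin by simp
    finally show False using indep xy(1,4) by fastforce
  qed
  have "independent (b ` X)"
  proof (rule independent_if_scalars_zero)
    fix c y assume "(\<Sum>y\<in>b ` X. sc (c y) y) = 0" "y \<in> b ` X"
    then show "c y = 0" using indep[of "c \<circ> b"] by (auto simp: sum.reindex[OF inj])
  qed (use fin in simp)
  moreover show sp: "V = span (b ` X)"
  proof (intro set_eqI iffI)
    fix v assume "v \<in> V"
    then obtain c where "v = (\<Sum>x\<in>X. sc (c x) (b x))" unfolding V ..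
    then show "v \<in> span (b ` X)" by (simp add: span_sum span_scale span_base)
  next
    fix v assume "v \<in> span (b ` X)"
    then obtain c where "v = (\<Sum>y\<in>b ` X. sc (c y) y)"
      using fin by (auto simp: span_finite)
    then show "v \<in> V" unfolding V by (auto simp: sum.reindex[OF inj] intro!: exI[of _ "\<lambda>x. c (b x)"])
  qed
  ultimately have "dim V = card (b ` X)" using dim_span_eq_card_independent by simp
  then show "dim V = card X" using card_image[OF inj] by simp
qed

text \<open>
  A basis modulo \<open>W\<close> joined with a basis of \<open>W\<close> is a basis of \<open>V\<close>. This determines the number of
  elements of every basis modulo \<open>W\<close>, so the definite description defining \<open>quotient_dim\<close> denotes.
\<close>

lemma quotient_dim_plus_dim:
  assumes sub: "CS.subspace V" "CS.subspace W" "W \<subseteq> V" and fin: "finite B0" "V \<subseteq> CS.span B0"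
  shows "quotient_dim V W + CS.dim W = CS.dim V"
proof -
  obtain A where A: "A \<subseteq> W" "CS.independent A" "W \<subseteq> CS.span A" "card A = CS.dim W"
    using CS.basis_exists by blast
  have spA: "CS.span A = W" using A sub(2) CS.span_minimal by blast
  have "A \<subseteq> V" using A sub by auto
  then obtain C where C: "A \<subseteq> C" "C \<subseteq> V" "CS.independent C" "V \<subseteq> CS.span C"
    using CS.maximal_independent_subset_extend A(2) by metis
  have finC: "finite C"
    using CS.independent_span_bound[OF fin(1) C(3)] C(2) fin(2) by auto
  have finA: "finite A" using finC C(1) finite_subset by blast
  have basis: "card B + card A = CS.dim V" if "basis_mod V W B" for B
  proof -
    have B: "finite B" "B \<subseteq> V" "\<And>c. (\<Sum>b\<in>B. cscale (c b) b) \<in> W \<Longrightarrow> \<forall>b\<in>B. c b = 0"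
      "\<And>v. v \<in> V \<Longrightarrow> \<exists>c. v - (\<Sum>b\<in>B. cscale (c b) b) \<in> W"
      using that unfolding basis_mod_def by blast+
    have disj: "B \<inter> A = {}"
    proof (rule ccontr)
      assume "B \<inter> A \<noteq> {}"
      then obtain b where b: "b \<in> B" "b \<in> A" by blast
      have "(\<Sum>x\<in>B. cscale (if x = b then 1 else 0) x) = (\<Sum>x\<in>B. if x = b then x else 0)"
        by (intro sum.cong refl) auto
      also have "\<dots> = b" using b B(1) by simp
      finally have "(\<Sum>x\<in>B. cscale (if x = b then 1 else 0) x) \<in> W" using b A(1) by auto
      from B(3)[OF this] b show False by auto
    qed
    have "CS.independent (B \<union> A)"
    proof (rule CS.independent_if_scalars_zero)
      fix c x assume 0: "(\<Sum>x\<in>B \<union> A. cscale (c x) x) = 0" and x: "x \<in> B \<union> A"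
      have s: "(\<Sum>x\<in>B. cscale (c x) x) + (\<Sum>x\<in>A. cscale (c x) x) = 0"
        using 0 disj finA B(1) by (simp add: sum.union_disjoint)
      have "- (\<Sum>x\<in>A. cscale (c x) x) \<in> CS.span A"
        by (intro CS.span_neg CS.span_sum CS.span_scale CS.span_base)
      then have "(\<Sum>x\<in>B. cscale (c x) x) \<in> W"
        using s spA by (simp add: flip: eq_neg_iff_add_eq_0)
      then have cB: "\<forall>x\<in>B. c x = 0" by (rule B(3))
      then have "(\<Sum>x\<in>A. cscale (c x) x) = 0" using s by simp
      then have "\<forall>x\<in>A. c x = 0" using CS.independentD[OF A(2) finA subset_refl] by blast
      with cB x show "c x = 0" by blast
    qed (use finA B in simp)
    moreover have "V \<subseteq> CS.span (B \<union> A)"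
    proof
      fix v assume "v \<in> V"
      then obtain c where "v - (\<Sum>b\<in>B. cscale (c b) b) \<in> W" using B(4) by blast
      then have "v - (\<Sum>b\<in>B. cscale (c b) b) \<in> CS.span (B \<union> A)"
        using spA CS.span_mono[of A "B \<union> A"] by blast
      moreover have "(\<Sum>b\<in>B. cscale (c b) b) \<in> CS.span (B \<union> A)"
        by (intro CS.span_sum CS.span_scale CS.span_base) auto
      ultimately show "v \<in> CS.span (B \<union> A)" using CS.span_add by fastforce
    qed
    ultimately have "card (B \<union> A) = CS.dim V"
      using \<open>A \<subseteq> V\<close> B(2) by (intro CS.basis_card_eq_dim) auto
    then show ?thesis using disj finA B(1) by (simp add: card_Un_disjoint)
  qed
  have bm: "basis_mod V W (C - A)"
    unfolding basis_mod_def
  proof (intro conjI allI impI ballI)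
    fix c b assume W: "(\<Sum>b\<in>C - A. cscale (c b) b) \<in> W" and b: "b \<in> C - A"
    have "(\<Sum>b\<in>C - A. cscale (c b) b) \<in> CS.span (C - A)"
      by (intro CS.span_sum CS.span_scale CS.span_base)
    then have "(\<Sum>b\<in>C - A. cscale (c b) b) = 0"
      using independent_disjoint_spans[OF CS.vector_space_axioms C(3) C(1)] W spA by blast
    then show "c b = 0"
      using CS.independentD[OF CS.independent_mono[OF C(3) Diff_subset] _ subset_refl] finC b by blast
  next
    fix v assume "v \<in> V"
    then obtain c where v: "v = (\<Sum>b\<in>C. cscale (c b) b)"
      using C(4) finC by (auto simp: CS.span_finite)
    have "v - (\<Sum>b\<in>C - A. cscale (c b) b) = (\<Sum>b\<in>A. cscale (c b) b)"
      unfolding v using sum.subset_diff[OF C(1) finC, of "\<lambda>b. cscale (c b) b"] by simp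
    moreover have "\<dots> \<in> CS.span A" by (intro CS.span_sum CS.span_scale CS.span_base)
    ultimately have "v - (\<Sum>b\<in>C - A. cscale (c b) b) \<in> W" using spA by simp
    then show "\<exists>c. v - (\<Sum>b\<in>C - A. cscale (c b) b) \<in> W" by (rule exI[of _ c])
  qed (use finC C(2) in auto)
  have "quotient_dim V W = card (C - A)"
    unfolding quotient_dim_def
  proof (rule the_equality)
    show "\<exists>B. basis_mod V W B \<and> card B = card (C - A)" using bm by blast
  next
    fix n assume "\<exists>B. basis_mod V W B \<and> card B = n"
    then show "n = card (C - A)" using basis basis[OF bm] by fastforce
  qed
  then show ?thesis using basis[OF bm] A(4) by simp
qed

section \<open>Graded pieces of free modules\<close>

text \<open>
  Exponent vectors of degree \<open>k\<close> are lists of four naturals with sum \<open>k\<close>.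
\<close>

lemma card_monomials:
  "finite {m. mon_degree m = k}" "card {m. mon_degree m = k} = (k + 3) choose 3"
proof -
  let ?L = "{l :: nat list. length l = 4 \<and> sum_list l = k}"
  let ?h = "\<lambda>m :: mon. [lookup m 1, lookup m 2, lookup m 3, lookup m 4]"
  let ?g = "\<lambda>l. Poly_Mapping.single (1::4) (l ! 0) + Poly_Mapping.single 2 (l ! 1)
      + Poly_Mapping.single 3 (l ! 2) + Poly_Mapping.single 4 (l ! 3)"
  have hg: "?h (?g l) = l" if "length l = 4" for l :: "nat list"
    using that by (auto simp: Poly_Mapping.lookup_add lookup_single list_eq_iff_nth_eq less_Suc_eq numeral_eq_Suc)
  have deg: "mon_degree m = sum_list (?h m)" for m
    by (simp add: mon_degree_def sum_4)
  have bij: "bij_betw ?h {m. mon_degree m = k} ?L"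
  proof (rule bij_betw_imageI)
    show "inj_on ?h {m. mon_degree m = k}"
      by (auto intro!: inj_onI simp: poly_mapping_eq_iff fun_eq_iff forall_4)
    show "?h ` {m. mon_degree m = k} = ?L"
    proof (intro equalityI subsetI)
      fix l assume "l \<in> ?L"
      then have "?h (?g l) = l" "mon_degree (?g l) = k" using hg[of l] deg[of "?g l"] by auto
      then show "l \<in> ?h ` {m. mon_degree m = k}" by (intro image_eqI[of _ _ "?g l"]) auto
    qed (auto simp: deg)
  qed
  have card: "card ?L = (k + 3) choose 3"
    using binomial_symmetric[of k "k + 3"] by (simp add: card_length_sum_list add.commute)
  have "finite ?L" using card by (intro card_ge_0_finite) simp
  then show "finite {m. mon_degree m = k}" using bij_betw_finite[OF bij] by simp
  show "card {m. mon_degree m = k} = (k + 3) choose 3" using bij_betw_same_card[OF bij] card by simp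
qed

lemma lookup_sum_single:
  assumes "finite A"
  shows "lookup (\<Sum>m\<in>A. Poly_Mapping.single m (c m)) n = (if n \<in> A then c n else 0)"
  using assms by (auto simp: lookup_sum lookup_single when_def)

lemma homogeneous_as_sum:
  assumes "homogeneous k p"
  shows "p = (\<Sum>m\<in>{m. mon_degree m = k}. Poly_Mapping.single m (lookup p m))"
  using assms by (intro poly_mapping_eqI)
    (auto simp: lookup_sum_single card_monomials homogeneous_def in_keys_iff)

lemma cscale_single [simp]: "cscale c (Poly_Mapping.single m a) = Poly_Mapping.single m (c * a)"
  by (simp add: cscale_def const_def mult_single)

lemma dim_graded_piece:
  "CS.dim (graded_piece k) = (k + 3) choose 3"
  "graded_piece k = CS.span ((\<lambda>m. Poly_Mapping.single m 1) ` {m. mon_degree m = k})"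
proof -
  have 1: "\<forall>m\<in>{m. mon_degree m = k}. c m = 0"
    if "(\<Sum>m\<in>{m. mon_degree m = k}. cscale (c m) (Poly_Mapping.single m 1)) = 0" for c
  proof
    fix n assume "n \<in> {m. mon_degree m = k}"
    then show "c n = 0"
      using lookup_sum_single[OF card_monomials(1)[of k], of c n] that by simp
  qed
  have 2: "p \<in> graded_piece k \<longleftrightarrow>
      (\<exists>c. p = (\<Sum>m\<in>{m. mon_degree m = k}. cscale (c m) (Poly_Mapping.single m 1)))" for p
  proof
    assume "p \<in> graded_piece k"
    then show "\<exists>c. p = (\<Sum>m\<in>{m. mon_degree m = k}. cscale (c m) (Poly_Mapping.single m 1))"
      using homogeneous_as_sum[of k p] by (intro exI[of _ "lookup p"]) (simp add: graded_piece_def)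
  qed (auto simp: graded_piece_def intro!: homogeneous_sum homogeneous_single)
  note d = dim_parametrized[OF CS.vector_space_axioms card_monomials(1) 1 2]
  show "CS.dim (graded_piece k) = (k + 3) choose 3" using d(1) by (simp add: card_monomials(2))
  show "graded_piece k = CS.span ((\<lambda>m. Poly_Mapping.single m 1) ` {m. mon_degree m = k})"
    by (rule d(2))
qed

lemma const_1 [simp]: "const 1 = 1"
  by (simp add: const_def)

interpretation V4: vector_space "\<lambda>c. (*s) (const c) :: quat_poly ^ 4 \<Rightarrow> quat_poly ^ 4"
  by standard
    (simp_all add: const_add const_mult)

text \<open>
  If \<open>M\<close> is free on homogeneous elements \<open>r i\<close> of degree \<open>e i\<close>, the products of \<open>r i\<close> with the monomials of
  degree \<open>q - e i\<close> form a complex basis of \<open>M\<close> in degree \<open>q\<close>.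
\<close>

lemma dim_graded_span:
  fixes r :: "'i \<Rightarrow> quat_poly ^ 4"
  assumes fin: "finite I" and hom: "\<And>i. i \<in> I \<Longrightarrow> homogeneous_vec (e i) (r i)"
    and indep: "\<And>p. (\<Sum>i\<in>I. p i *s r i) = 0 \<Longrightarrow> \<forall>i\<in>I. p i = 0"
    and M: "\<And>v. v \<in> M \<longleftrightarrow> (\<exists>p. v = (\<Sum>i\<in>I. p i *s r i))"
  shows "V4.dim {v \<in> M. homogeneous_vec q v} = (\<Sum>i\<in>I. if e i \<le> q then (q - e i + 3) choose 3 else 0)"
    and "\<exists>B. finite B \<and> {v \<in> M. homogeneous_vec q v} = V4.span B"
proof -
  let ?A = "\<lambda>i. {m. mon_degree m + e i = q}"
  have A: "?A i = (if e i \<le> q then {m. mon_degree m = q - e i} else {})" for i by auto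
  have finA: "finite (?A i)" for i unfolding A by (simp add: card_monomials)
  let ?X = "Sigma I ?A"
  let ?b = "\<lambda>(i, m). Poly_Mapping.single m 1 *s r i"
  have finX: "finite ?X" using fin finA by blast
  have sum: "(\<Sum>x\<in>?X. const (c x) *s ?b x) = (\<Sum>i\<in>I. (\<Sum>m\<in>?A i. Poly_Mapping.single m (c (i, m))) *s r i)"
    for c
  proof -
    have "(\<Sum>x\<in>?X. const (c x) *s ?b x) = (\<Sum>i\<in>I. \<Sum>m\<in>?A i. const (c (i, m)) *s ?b (i, m))"
      using sum.Sigma[of I ?A "\<lambda>i m. const (c (i, m)) *s ?b (i, m)"] fin finA
      by (simp add: split_def)
    also have "\<dots> = (\<Sum>i\<in>I. (\<Sum>m\<in>?A i. Poly_Mapping.single m (c (i, m))) *s r i)"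
      by (intro sum.cong refl) (simp add: const_def mult_single S4.scale_sum_left)
    finally show ?thesis .
  qed
  have 1: "\<forall>x\<in>?X. c x = 0" if 0: "(\<Sum>x\<in>?X. const (c x) *s ?b x) = 0" for c
  proof clarify
    fix i m assume i: "i \<in> I" and m: "q = mon_degree m + e i"
    have "(\<Sum>m\<in>?A i. Poly_Mapping.single m (c (i, m))) = 0"
      using indep[of "\<lambda>i. \<Sum>m\<in>?A i. Poly_Mapping.single m (c (i, m))"] 0 i unfolding sum by blast
    then show "c (i, m) = 0"
      using lookup_sum_single[OF finA[of i], of "\<lambda>m. c (i, m)" m] m by simp
  qed
  have homogeneous_r: "homogeneous k (p * r i $ j)"
    if "i \<in> I" "k = l + e i" "homogeneous l p" for i j k l p
    using that hom[OF that(1)] by (auto simp: homogeneous_vec_def intro!: homogeneous_mult)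
  have 2: "v \<in> {v \<in> M. homogeneous_vec q v} \<longleftrightarrow> (\<exists>c. v = (\<Sum>x\<in>?X. const (c x) *s ?b x))" for v
  proof
    assume "v \<in> {v \<in> M. homogeneous_vec q v}"
    then obtain p where p: "v = (\<Sum>i\<in>I. p i *s r i)" and v: "homogeneous_vec q v"
      using M by blast
    define c where "c = (\<lambda>(i, m). lookup (p i) m)"
    have "v = (\<Sum>i\<in>I. (\<Sum>m\<in>?A i. Poly_Mapping.single m (c (i, m))) *s r i)"
    proof (subst vec_eq_iff, intro allI)
      fix j
      have "v $ j = homog_part q (v $ j)"
        using v by (simp add: homogeneous_vec_def homogeneous_iff_homog_part)
      also have "\<dots> = (\<Sum>i\<in>I. homog_part q (p i * r i $ j))"
        unfolding p by (simp add: homog_part_sum)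
      also have "\<dots> = (\<Sum>i\<in>I. (\<Sum>m\<in>?A i. Poly_Mapping.single m (c (i, m))) * r i $ j)"
      proof (intro sum.cong refl)
        fix i assume i: "i \<in> I"
        have "homogeneous (e i) (r i $ j)" using hom[OF i] by (simp add: homogeneous_vec_def)
        moreover have "(\<Sum>m\<in>?A i. Poly_Mapping.single m (c (i, m))) =
            (if e i \<le> q then homog_part (q - e i) (p i) else 0)"
        proof (rule poly_mapping_eqI)
          fix n
          show "lookup (\<Sum>m\<in>?A i. Poly_Mapping.single m (c (i, m))) n =
            lookup (if e i \<le> q then homog_part (q - e i) (p i) else 0) n"
            unfolding lookup_sum_single[OF finA] by (auto simp: c_def lookup_homog_part when_def)
        qed
        ultimately show "homog_part q (p i * r i $ j) = (\<Sum>m\<in>?A i. Poly_Mapping.single m (c (i, m))) * r i $ j"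
          by (simp add: homog_part_mult_homogeneous)
      qed
      finally show "v $ j = (\<Sum>i\<in>I. (\<Sum>m\<in>?A i. Poly_Mapping.single m (c (i, m))) *s r i) $ j"
        by simp
    qed
    then show "\<exists>c. v = (\<Sum>x\<in>?X. const (c x) *s ?b x)" unfolding sum by (rule exI[of _ c])
  next
    assume "\<exists>c. v = (\<Sum>x\<in>?X. const (c x) *s ?b x)"
    then obtain c where c: "v = (\<Sum>i\<in>I. (\<Sum>m\<in>?A i. Poly_Mapping.single m (c (i, m))) *s r i)"
      unfolding sum ..
    have "v \<in> M" unfolding M c by (rule exI[of _ "\<lambda>i. \<Sum>m\<in>?A i. Poly_Mapping.single m (c (i, m))"]) simp
    moreover have "homogeneous_vec q v"
      unfolding homogeneous_vec_def c sum_component vector_smult_component sum_distrib_right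
      by (intro allI homogeneous_sum, rule homogeneous_r)
        (auto intro: homogeneous_single)
    ultimately show "v \<in> {v \<in> M. homogeneous_vec q v}" by simp
  qed
  note d = dim_parametrized[OF V4.vector_space_axioms finX 1 2]
  have "card ?X = (\<Sum>i\<in>I. card (?A i))" using fin finA by simp
  also have "\<dots> = (\<Sum>i\<in>I. if e i \<le> q then (q - e i + 3) choose 3 else 0)"
    by (intro sum.cong refl) (simp add: A card_monomials)
  finally show "V4.dim {v \<in> M. homogeneous_vec q v} = (\<Sum>i\<in>I. if e i \<le> q then (q - e i + 3) choose 3 else 0)"
    using d(1) by simp
  show "\<exists>B. finite B \<and> {v \<in> M. homogeneous_vec q v} = V4.span B"
    using d(2) finX by (intro exI[of _ "?b ` ?X"]) auto
qed

section \<open>The Hilbert function of the Milnor algebra\<close>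

text \<open>
  Indexing the combinations by \<open>i\<close> rather than by the values \<open>F i\<close> covers repeated generators.
\<close>

lemma in_ideal_span_range:
  "x \<in> ideal.span (range F) \<longleftrightarrow> (\<exists>a :: quat_poly ^ 4. x = (\<Sum>i\<in>UNIV. a $ i * F i))"
proof
  let ?M = "{x. \<exists>a :: quat_poly ^ 4. x = (\<Sum>i\<in>UNIV. a $ i * F i)}"
  have "ideal.span (range F) \<subseteq> ?M"
  proof (rule ideal.span_minimal)
    show "range F \<subseteq> ?M"
    proof clarify
      fix j
      have "F j = (\<Sum>i\<in>UNIV. axis j 1 $ i * F i)"
        by (simp add: axis_def if_distrib [where f = "\<lambda>x. x * _"] cong: if_cong)
      then show "\<exists>a :: quat_poly ^ 4. F j = (\<Sum>i\<in>UNIV. a $ i * F i)" by (rule exI)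
    qed
    show "ideal.subspace ?M"
    proof (rule ideal.subspaceI)
      show "0 \<in> ?M" by (auto intro!: exI[of _ 0])
    next
      fix x y assume "x \<in> ?M" "y \<in> ?M"
      then obtain a b :: "quat_poly ^ 4"
        where "x = (\<Sum>i\<in>UNIV. a $ i * F i)" "y = (\<Sum>i\<in>UNIV. b $ i * F i)" by blast
      then have "x + y = (\<Sum>i\<in>UNIV. (a + b) $ i * F i)" by (simp add: distrib_right sum.distrib)
      then show "x + y \<in> ?M" unfolding mem_Collect_eq by (rule exI)
    next
      fix c x :: quat_poly assume "x \<in> ?M"
      then obtain a :: "quat_poly ^ 4" where "x = (\<Sum>i\<in>UNIV. a $ i * F i)"
        unfolding mem_Collect_eq by (rule exE)
      then have "c * x = (\<Sum>i\<in>UNIV. (c *s a) $ i * F i)"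
        by (simp only: sum_distrib_left vector_smult_component mult.assoc)
      then show "c * x \<in> ?M" unfolding mem_Collect_eq by (rule exI)
    qed
  qed
  then show "x \<in> ideal.span (range F) \<Longrightarrow> \<exists>a :: quat_poly ^ 4. x = (\<Sum>i\<in>UNIV. a $ i * F i)" by blast
next
  assume "\<exists>a :: quat_poly ^ 4. x = (\<Sum>i\<in>UNIV. a $ i * F i)"
  then obtain a :: "quat_poly ^ 4" where "x = (\<Sum>i\<in>UNIV. a $ i * F i)" by (rule exE)
  then show "x \<in> ideal.span (range F)"
    by (simp add: ideal.span_sum ideal.span_scale ideal.span_base)
qed

lemma sum_axis: "(v :: 'a::comm_ring_1 ^ 'n) = (\<Sum>i\<in>UNIV. v $ i *s axis i 1)"
  by (simp add: vec_eq_iff axis_def if_distrib[where f = "\<lambda>x. _ * x"] cong: if_cong)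

lemma dim_homogeneous_vec:
  "V4.dim {v. homogeneous_vec q v} = 4 * ((q + 3) choose 3)"
  "\<exists>B. finite B \<and> {v. homogeneous_vec q v} = V4.span B"
proof -
  have 1: "homogeneous_vec 0 (axis i 1)" for i
    by (simp add: homogeneous_vec_def axis_def homogeneous_def)
  have 2: "\<forall>i\<in>UNIV. p i = 0" if 0: "(\<Sum>i\<in>UNIV. p i *s axis i 1) = (0::quat_poly ^ 4)" for p
  proof
    fix i
    have "(\<Sum>i\<in>UNIV. p i *s axis i (1::quat_poly)) $ i = p i"
      by (simp add: axis_def if_distrib[where f = "\<lambda>x. _ * x"] cong: if_cong)
    then show "p i = 0" using 0 by simp
  qed
  have 3: "v \<in> UNIV \<longleftrightarrow> (\<exists>p. v = (\<Sum>i\<in>UNIV. p i *s axis i (1::quat_poly)))" for v :: "quat_poly ^ 4"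
    using exI[of "\<lambda>p. v = (\<Sum>i\<in>UNIV. p i *s axis i 1)" "\<lambda>i. v $ i", OF sum_axis] by simp
  note d = dim_graded_span[OF finite 1 2 3, of q]
  show "V4.dim {v. homogeneous_vec q v} = 4 * ((q + 3) choose 3)" using d(1) by simp
  show "\<exists>B. finite B \<and> {v. homogeneous_vec q v} = V4.span B" using d(2) by simp
qed

lemma homog_part_combination:
  assumes "\<And>i. homogeneous e (F i)"
  shows "homog_part k (\<Sum>i\<in>UNIV. a $ i * F i)
    = (if e \<le> k then \<Sum>i\<in>UNIV. (\<chi> i. homog_part (k - e) (a $ i)) $ i * F i else 0)"
  by (simp add: homog_part_sum homog_part_mult_homogeneous[OF assms])

text \<open>
  Rank-nullity for the surjection \<open>a \<mapsto> \<Sum>\<^sub>i a\<^sub>i F\<^sub>i\<close> onto the degree \<open>q + e\<close> part of the ideal. It is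
  onto because the components of \<open>a\<close> in degree \<open>q\<close> already produce the value.
\<close>

lemma dim_ideal_plus_dim_syzygies:
  fixes F :: "4 \<Rightarrow> quat_poly"
  assumes F: "\<And>i. homogeneous e (F i)"
  shows "CS.dim (ideal.span (range F) \<inter> graded_piece (q + e))
      + V4.dim {a. (\<Sum>i\<in>UNIV. a $ i * F i) = 0 \<and> homogeneous_vec q a} = 4 * ((q + 3) choose 3)"
proof -
  let ?h = "\<lambda>a :: quat_poly ^ 4. \<Sum>i\<in>UNIV. a $ i * F i"
  let ?V = "{a. homogeneous_vec q a}"
  have lin: "Vector_Spaces.linear (\<lambda>c. (*s) (const c)) cscale ?h"
    unfolding Vector_Spaces.linear_iff
    using V4.vector_space_axioms CS.vector_space_axioms
    by (simp add: distrib_right sum.distrib)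
      (simp only: cscale_def sum_distrib_left mult.assoc simp_thms)
  obtain B where B: "finite B" "?V = V4.span B" using dim_homogeneous_vec(2) by blast
  have "?h ` ?V = ideal.span (range F) \<inter> graded_piece (q + e)"
  proof (intro equalityI subsetI)
    fix x assume "x \<in> ?h ` ?V"
    then obtain a where "x = ?h a" "homogeneous_vec q a" by blast
    moreover have "?h a \<in> ideal.span (range F)" unfolding in_ideal_span_range by blast
    ultimately show "x \<in> ideal.span (range F) \<inter> graded_piece (q + e)"
      by (auto simp: graded_piece_def homogeneous_vec_def intro!: homogeneous_sum homogeneous_mult F)
  next
    fix x assume "x \<in> ideal.span (range F) \<inter> graded_piece (q + e)"
    then obtain a where a: "x = ?h a" and x: "homogeneous (q + e) x"
      using in_ideal_span_range[of x F] by (auto simp: graded_piece_def)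
    have "x = homog_part (q + e) (?h a)" using x a by (simp add: homogeneous_iff_homog_part)
    also have "\<dots> = ?h (\<chi> i. homog_part q (a $ i))" unfolding homog_part_combination[OF F] by simp
    finally show "x \<in> ?h ` ?V"
      by (rule image_eqI) (simp add: homogeneous_vec_def homogeneous_homog_part)
  qed
  moreover have "{a \<in> ?V. ?h a = 0} = {a. ?h a = 0 \<and> homogeneous_vec q a}" by blast
  ultimately show ?thesis
    using rank_nullity[OF lin, of ?V B] B dim_homogeneous_vec(1)[of q] V4.subspace_span[of B] by simp
qed

lemma ideal_low_degree:
  fixes F :: "4 \<Rightarrow> quat_poly"
  assumes F: "\<And>i. homogeneous e (F i)" and "x \<in> ideal.span (range F)" "homogeneous k x" "k < e"
  shows "x = 0"
proof -
  obtain a :: "quat_poly ^ 4" where "x = (\<Sum>i\<in>UNIV. a $ i * F i)"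
    using assms(2) unfolding in_ideal_span_range by blast
  then have "homog_part k x = 0" using homog_part_combination[of e F, OF F] assms(4) by simp
  then show "x = 0" using assms(3) by (simp add: homogeneous_iff_homog_part)
qed

text \<open>
  Written additively, as the dimensions are natural numbers.
\<close>

lemma hilbert_fun_plus:
  assumes f: "homogeneous d f"
  shows "hilbert_fun f k + (if d - 1 \<le> k then 4 * ((k - (d - 1) + 3) choose 3) else 0)
    = ((k + 3) choose 3) + (if d - 1 \<le> k then V4.dim {a \<in> AR f. homogeneous_vec (k - (d - 1)) a} else 0)"
proof -
  let ?W = "jacobian_ideal f \<inter> graded_piece k"
  have F: "homogeneous (d - 1) (partial i f)" for i by (rule homogeneous_partial[OF f])
  have sub: "CS.subspace (graded_piece k)" "CS.subspace ?W"
  proof -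
    show *: "CS.subspace (graded_piece k)" unfolding dim_graded_piece(2) by (rule CS.subspace_span)
    have "CS.subspace (jacobian_ideal f)"
      unfolding jacobian_ideal_def CS.subspace_def cscale_def
      by (auto intro: ideal.span_zero ideal.span_add ideal.span_scale)
    then show "CS.subspace ?W" using * by (rule CS.subspace_inter)
  qed
  have 1: "hilbert_fun f k + CS.dim ?W = (k + 3) choose 3"
    unfolding hilbert_fun_def dim_graded_piece(1)[symmetric]
  proof (rule quotient_dim_plus_dim[OF sub])
    show "finite ((\<lambda>m. Poly_Mapping.single m (1::complex)) ` {m. mon_degree m = k})"
      by (simp add: card_monomials)
    show "graded_piece k \<subseteq> CS.span ((\<lambda>m. Poly_Mapping.single m 1) ` {m. mon_degree m = k})"
      using dim_graded_piece(2) by blast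
  qed simp
  show ?thesis
  proof (cases "d - 1 \<le> k")
    case True
    then show ?thesis
      using 1 dim_ideal_plus_dim_syzygies[of "d - 1" "\<lambda>i. partial i f" "k - (d - 1)", OF F]
      by (simp add: jacobian_ideal_def AR_def)
  next
    case False
    have "?W \<subseteq> {0}"
      using False ideal_low_degree[of "d - 1" "\<lambda>i. partial i f", OF F] by (auto simp: jacobian_ideal_def graded_piece_def)
    then have "CS.dim ?W = 0"
      using CS.dim_le_card[of ?W "{}"] by simp
    then show ?thesis using False 1 by simp
  qed
qed

lemma free_with_exponentsE:
  assumes "free_with_exponents f d1 d2 d3"
  obtains a b c where "homogeneous_vec d1 a" "homogeneous_vec d2 b" "homogeneous_vec d3 c"
    "\<And>p q r. p *s a + q *s b + r *s c = 0 \<Longrightarrow> p = 0 \<and> q = 0 \<and> r = 0"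
    "\<And>v. v \<in> AR f \<longleftrightarrow> (\<exists>p q r. v = p *s a + q *s b + r *s c)"
proof -
  obtain a b c where abc: "distinct [a, b, c]" "homogeneous_vec d1 a" "homogeneous_vec d2 b"
    "homogeneous_vec d3 c" "\<not> S4.dependent {a, b, c}" "S4.span {a, b, c} = AR f"
    using assms unfolding free_with_exponents_def by blast
  have sum: "(\<Sum>v\<in>{a, b, c}. u v *s v) = u a *s a + u b *s b + u c *s c" for u
    using abc(1) by (simp add: add.assoc)
  have "p = 0 \<and> q = 0 \<and> r = 0" if "p *s a + q *s b + r *s c = 0" for p q r
  proof -
    define u where "u v = (if v = a then p else if v = b then q else r)" for v
    have u: "u a = p" "u b = q" "u c = r" using abc(1) by (auto simp: u_def)
    have "(\<Sum>v\<in>{a, b, c}. u v *s v) = 0" unfolding sum u by (rule that)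
    then have "u v = 0" if "v \<in> {a, b, c}" for v
      using S4.independentD[OF abc(5) _ subset_refl _ that] by blast
    then show ?thesis using u by auto
  qed
  moreover have "v \<in> AR f \<longleftrightarrow> (\<exists>p q r. v = p *s a + q *s b + r *s c)" for v
  proof
    assume "v \<in> AR f"
    then obtain u where "v = (\<Sum>v\<in>{a, b, c}. u v *s v)"
      unfolding abc(6)[symmetric] by (auto simp: S4.span_finite simp del: sum.insert)
    then show "\<exists>p q r. v = p *s a + q *s b + r *s c" unfolding sum by blast
  next
    assume "\<exists>p q r. v = p *s a + q *s b + r *s c"
    then obtain p q r where "v = p *s a + q *s b + r *s c" by blast
    then show "v \<in> AR f"
      unfolding abc(6)[symmetric] by (simp add: S4.span_add S4.span_scale S4.span_base)
  qed
  ultimately show thesis using that abc(2-4) by blast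
qed

lemma dim_syzygies_free:
  assumes "free_with_exponents f d1 d2 d3"
  shows "V4.dim {a \<in> AR f. homogeneous_vec q a}
    = (\<Sum>e\<leftarrow>[d1, d2, d3]. if e \<le> q then (q - e + 3) choose 3 else 0)"
proof -
  obtain a b c where abc: "homogeneous_vec d1 a" "homogeneous_vec d2 b" "homogeneous_vec d3 c"
    "\<And>p q r. p *s a + q *s b + r *s c = 0 \<Longrightarrow> p = 0 \<and> q = 0 \<and> r = 0"
    "\<And>v. v \<in> AR f \<longleftrightarrow> (\<exists>p q r. v = p *s a + q *s b + r *s c)"
    using free_with_exponentsE[OF assms] by metis
  have all3: "(\<forall>i\<in>{..<3::nat}. P i) \<longleftrightarrow> P 0 \<and> P 1 \<and> P 2" for P
    by (auto simp: less_Suc_eq numeral_3_eq_3 numeral_2_eq_2)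
  have sum3: "(\<Sum>i<3. g i) = g 0 + g 1 + g 2" for g :: "nat \<Rightarrow> 'z::comm_monoid_add"
    by (simp add: numeral_3_eq_3 numeral_2_eq_2 add.assoc)
  have 1: "homogeneous_vec ([d1, d2, d3] ! i) ([a, b, c] ! i)" if "i \<in> {..<3}" for i
    using that abc(1-3) by (auto simp: less_Suc_eq numeral_3_eq_3)
  have 2: "\<forall>i\<in>{..<3}. p i = 0" if "(\<Sum>i<3. p i *s [a, b, c] ! i) = 0" for p
    using abc(4)[of "p 0" "p 1" "p 2"] that unfolding all3 sum3 by simp
  have 3: "v \<in> AR f \<longleftrightarrow> (\<exists>p. v = (\<Sum>i<3. p i *s [a, b, c] ! i))" for v
  proof
    assume "v \<in> AR f"
    then obtain p q r where "v = p *s a + q *s b + r *s c" using abc(5) by blast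
    then have "v = (\<Sum>i<3. ([p, q, r] ! i) *s [a, b, c] ! i)" by (simp add: sum3)
    then show "\<exists>p. v = (\<Sum>i<3. p i *s [a, b, c] ! i)" by (rule exI[of _ "\<lambda>i. [p, q, r] ! i"])
  next
    assume "\<exists>p. v = (\<Sum>i<3. p i *s [a, b, c] ! i)"
    then show "v \<in> AR f" unfolding abc(5) sum3 by auto
  qed
  show ?thesis
    using dim_graded_span(1)[OF finite_lessThan 1 2 3, of q] by (simp add: sum3)
qed

section \<open>The Koszul complex of an ideal containing powers of the variables\<close>

lemma in_span_insert_iff: "x \<in> ideal.span (insert a S) \<longleftrightarrow> (\<exists>u. x - u * a \<in> ideal.span S)"
  unfolding ideal.span_insert by simp

text \<open>
  Vanishing of the first Koszul homology of \<open>F\<close>, given a regular sequence \<open>g\<^sub>1, g\<^sub>2, g\<^sub>3, g\<^sub>4\<close> inside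
  the ideal of \<open>F\<close>. Let \<open>\<partial>\<close> be contraction with \<open>F\<close> on the exterior algebra of \<open>S\<^sup>4\<close>, so that
  \<open>\<partial>(c \<and> x) = (c \<cdot> F) x - c \<and> \<partial>x\<close> and \<open>\<partial>a = 0\<close>. Wedging \<open>a\<close> successively with \<open>c\<^sub>1, c\<^sub>2, c\<^sub>3\<close>, where
  \<open>g\<^sub>j = c\<^sub>j \<cdot> F\<close>, leads to a top form \<open>h\<close> that is a cycle modulo \<open>g\<^sub>1, g\<^sub>2, g\<^sub>3\<close>; so \<open>g\<^sub>4 h\<close>, and
  therefore \<open>h\<close>, vanishes modulo these. Cancelling \<open>g\<^sub>3\<close>, \<open>g\<^sub>2\<close>, \<open>g\<^sub>1\<close> in turn makes \<open>c\<^sub>2 \<and> c\<^sub>1 \<and> a\<close>,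
  \<open>c\<^sub>1 \<and> a\<close> and finally \<open>a\<close> a boundary modulo the remaining \<open>g\<^sub>j\<close>. Three-forms are written
  as vectors, with \<open>signed_minor\<close> for a wedge of three vectors; under this identification the
  boundary of the volume form is \<open>F\<close>.
\<close>

lemma koszul_unwinding:
  fixes F a c1 c2 c3 c4 :: "quat_poly ^ 4" and g1 g2 g3 g4 :: quat_poly
  assumes g: "g1 = (\<Sum>i\<in>UNIV. c1 $ i * F $ i)" "g2 = (\<Sum>i\<in>UNIV. c2 $ i * F $ i)"
      "g3 = (\<Sum>i\<in>UNIV. c3 $ i * F $ i)" "g4 = (\<Sum>i\<in>UNIV. c4 $ i * F $ i)"
    and reg: "g1 \<noteq> 0" "\<And>p. g2 * p \<in> ideal.span {g1} \<Longrightarrow> p \<in> ideal.span {g1}"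
      "\<And>p. g3 * p \<in> ideal.span {g2, g1} \<Longrightarrow> p \<in> ideal.span {g2, g1}"
      "\<And>p. g4 * p \<in> ideal.span {g3, g2, g1} \<Longrightarrow> p \<in> ideal.span {g3, g2, g1}"
    and a: "(\<Sum>i\<in>UNIV. a $ i * F $ i) = 0"
  shows "a $ k \<in> ideal.span (range (($) F))"
proof -
  define B where "B = signed_minor c2 c1 a"
  define h where "h = (\<Sum>l\<in>UNIV. c3 $ l * B l)"
  note sm = signed_minor_def minor_def
  have in1: "p \<in> ideal.span {g1} \<longleftrightarrow> (\<exists>u. p = u * g1)" for p
    by (simp add: in_span_insert_iff)
  have in2: "p \<in> ideal.span {g2, g1} \<longleftrightarrow> (\<exists>u v. p = u * g2 + v * g1)" for p
    unfolding in_span_insert_iff[of p g2] in1 by (simp add: algebra_simps)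
  have in3: "p \<in> ideal.span {g3, g2, g1} \<longleftrightarrow> (\<exists>u v w. p = u * g3 + v * g2 + w * g1)" for p
    unfolding in_span_insert_iff[of p g3] in2 by (simp add: algebra_simps)
  \<comment> \<open>Apply the boundary to the top form obtained by wedging \<open>a\<close> with \<open>c\<^sub>1, c\<^sub>2, c\<^sub>3\<close>; the term with \<open>\<partial>a\<close> drops.\<close>
  have hF: "h * F $ l = g3 * B l - g2 * signed_minor c3 c1 a l + g1 * signed_minor c3 c2 a l" for l
  proof -
    have "\<forall>l. h * F $ l = g3 * B l - g2 * signed_minor c3 c1 a l + g1 * signed_minor c3 c2 a l
      - (\<Sum>i\<in>UNIV. a $ i * F $ i) * signed_minor c3 c2 c1 l"
      unfolding forall_4 h_def g B_def sum_4 by (simp add: sm) algebra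
    then show ?thesis using a by simp
  qed
  have "g4 * h = (\<Sum>l\<in>UNIV. c4 $ l * (h * F $ l))"
    unfolding g sum_distrib_right by (intro sum.cong refl) (simp only: mult_ac)
  also have "\<dots> \<in> ideal.span {g3, g2, g1}"
  proof (rule ideal.span_sum, rule ideal.span_scale)
    fix l
    have "h * F $ l = B l * g3 + (- signed_minor c3 c1 a l) * g2 + signed_minor c3 c2 a l * g1"
      unfolding hF by algebra
    then show "h * F $ l \<in> ideal.span {g3, g2, g1}" unfolding in3 by blast
  qed
  finally have "h \<in> ideal.span {g3, g2, g1}" by (rule reg(4))
  then obtain u3 u2 u1 where h: "h = u3 * g3 + u2 * g2 + u1 * g1"
    unfolding in3 by (elim exE)
  have "\<exists>q p. B l - u3 * F $ l = q * g2 + p * g1" for l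
  proof -
    have "g3 * (B l - u3 * F $ l) = (u2 * F $ l + signed_minor c3 c1 a l) * g2 + (u1 * F $ l - signed_minor c3 c2 a l) * g1"
      using hF[of l] unfolding h by algebra
    then have "g3 * (B l - u3 * F $ l) \<in> ideal.span {g2, g1}" unfolding in2 by (intro exI)
    then show ?thesis unfolding in2[symmetric] by (rule reg(3))
  qed
  then obtain q p where qp: "\<And>l. B l - u3 * F $ l = q l * g2 + p l * g1" by metis
  then have B: "B l = u3 * F $ l + q l * g2 + p l * g1" for l by (simp add: diff_eq_eq add_ac)
  \<comment> \<open>The differences \<open>F\<^sub>i q\<^sub>j - F\<^sub>j q\<^sub>i\<close> are the components of the boundary of the three-form \<open>q\<close>; the multiple
    \<open>u\<^sub>3 F\<close> of the boundary of the volume form cancels in them.\<close>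
  have step: "\<exists>s. w - (F $ i * q j - F $ j * q i) = s * g1"
    if "g2 * w = F $ i * B j - F $ j * B i + g1 * w'" for w w' i j
  proof -
    have "g2 * (w - (F $ i * q j - F $ j * q i)) = (w' + F $ i * p j - F $ j * p i) * g1"
      using that unfolding B by algebra
    then have "g2 * (w - (F $ i * q j - F $ j * q i)) \<in> ideal.span {g1}" unfolding in1 by (intro exI)
    then show ?thesis unfolding in1[symmetric] by (rule reg(2))
  qed
  let ?w = "\<lambda>c j k. c $ j * a $ k - c $ k * a $ j"
  \<comment> \<open>The boundary of \<open>c\<^sub>2 \<and> c\<^sub>1 \<and> a\<close>, one equation for each pair of indices.\<close>
  have w: "g2 * ?w c1 1 2 = F $ 4 * B 3 - F $ 3 * B 4 + g1 * ?w c2 1 2"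
    "g2 * ?w c1 1 3 = F $ 2 * B 4 - F $ 4 * B 2 + g1 * ?w c2 1 3"
    "g2 * ?w c1 1 4 = F $ 3 * B 2 - F $ 2 * B 3 + g1 * ?w c2 1 4"
    "g2 * ?w c1 2 3 = F $ 4 * B 1 - F $ 1 * B 4 + g1 * ?w c2 2 3"
    "g2 * ?w c1 2 4 = F $ 1 * B 3 - F $ 3 * B 1 + g1 * ?w c2 2 4"
    "g2 * ?w c1 3 4 = F $ 2 * B 1 - F $ 1 * B 2 + g1 * ?w c2 3 4"
    using a unfolding g B_def sum_4 by (simp_all add: sm) algebra+
  obtain s12 where s12: "?w c1 1 2 - (F $ 4 * q 3 - F $ 3 * q 4) = s12 * g1" using step[OF w(1)] by blast
  obtain s13 where s13: "?w c1 1 3 - (F $ 2 * q 4 - F $ 4 * q 2) = s13 * g1" using step[OF w(2)] by blast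
  obtain s14 where s14: "?w c1 1 4 - (F $ 3 * q 2 - F $ 2 * q 3) = s14 * g1" using step[OF w(3)] by blast
  obtain s23 where s23: "?w c1 2 3 - (F $ 4 * q 1 - F $ 1 * q 4) = s23 * g1" using step[OF w(4)] by blast
  obtain s24 where s24: "?w c1 2 4 - (F $ 1 * q 3 - F $ 3 * q 1) = s24 * g1" using step[OF w(5)] by blast
  obtain s34 where s34: "?w c1 3 4 - (F $ 2 * q 1 - F $ 1 * q 2) = s34 * g1" using step[OF w(6)] by blast
  note eqs = s12 s13 s14 s23 s24 s34
  \<comment> \<open>Contract \<open>c\<^sub>1 \<and> a = \<partial>q + g\<^sub>1 s\<close> with \<open>F\<close>, using \<open>\<partial>\<partial>q = 0\<close>.\<close>
  have "g1 * a $ 1 = g1 * (- s12 * F $ 2 - s13 * F $ 3 - s14 * F $ 4)"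
    "g1 * a $ 2 = g1 * (s12 * F $ 1 - s23 * F $ 3 - s24 * F $ 4)"
    "g1 * a $ 3 = g1 * (s13 * F $ 1 + s23 * F $ 2 - s34 * F $ 4)"
    "g1 * a $ 4 = g1 * (s14 * F $ 1 + s24 * F $ 2 + s34 * F $ 3)"
    using a eqs g(1) unfolding sum_4 by algebra+
  then have "a $ 1 = - s12 * F $ 2 - s13 * F $ 3 - s14 * F $ 4"
    "a $ 2 = s12 * F $ 1 - s23 * F $ 3 - s24 * F $ 4"
    "a $ 3 = s13 * F $ 1 + s23 * F $ 2 - s34 * F $ 4"
    "a $ 4 = s14 * F $ 1 + s24 * F $ 2 + s34 * F $ 3"
    using reg(1) by simp_all
  then have "\<forall>k. a $ k \<in> ideal.span (range (($) F))"
    unfolding forall_4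
    by (simp add: ideal.span_add ideal.span_diff ideal.span_neg ideal.span_scale ideal.span_base)
  then show ?thesis by blast
qed


lemma variable_power: "variable i ^ n = Poly_Mapping.single (Poly_Mapping.single i n) 1"
proof (induction n)
  case (Suc n)
  have "Poly_Mapping.single i (1::nat) + Poly_Mapping.single i n = Poly_Mapping.single i (Suc n)"
    by (simp flip: single_add)
  then show ?case using Suc by (simp add: variable_def mult_single)
qed simp

lemma lookup_single_times: "lookup (Poly_Mapping.single n 1 * (p :: quat_poly)) (n + m) = lookup p m"
  by (induction p rule: additive_induct)
    (simp_all add: mult_single lookup_single when_def distrib_left Poly_Mapping.lookup_add)

text \<open>
  Membership in a monomial ideal is decided monomial by monomial.
\<close>

lemma in_monomial_ideal_iff:
  "p \<in> ideal.span ((\<lambda>j. variable j ^ n) ` T) \<longleftrightarrow> (\<forall>m\<in>keys p. \<exists>j\<in>T. n \<le> lookup m j)"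
proof
  let ?M = "{p :: quat_poly. \<forall>m\<in>keys p. \<exists>j\<in>T. n \<le> lookup m j}"
  have "ideal.span ((\<lambda>j. variable j ^ n) ` T) \<subseteq> ?M"
  proof (rule ideal.span_minimal)
    show "(\<lambda>j. variable j ^ n) ` T \<subseteq> ?M"
      by (force simp: variable_power)
    show "ideal.subspace ?M"
    proof (rule ideal.subspaceI)
      fix p q assume "p \<in> ?M" "q \<in> ?M"
      then show "p + q \<in> ?M" using Poly_Mapping.keys_add[of p q] by blast
    next
      fix c p assume p: "p \<in> ?M"
      show "c * p \<in> ?M"
      proof (intro CollectI ballI)
        fix m assume "m \<in> keys (c * p)"
        then obtain k l where "m = k + l" "l \<in> keys p" using keys_mult[of c p] by blast
        with p obtain j where "j \<in> T" "n \<le> lookup l j" by blast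
        then show "\<exists>j\<in>T. n \<le> lookup m j"
          by (intro bexI[of _ j]) (auto simp: \<open>m = k + l\<close> Poly_Mapping.lookup_add)
      qed
    qed simp
  qed
  then show "p \<in> ideal.span ((\<lambda>j. variable j ^ n) ` T) \<Longrightarrow> \<forall>m\<in>keys p. \<exists>j\<in>T. n \<le> lookup m j" by blast
next
  assume p: "\<forall>m\<in>keys p. \<exists>j\<in>T. n \<le> lookup m j"
  have "(\<Sum>m\<in>keys p. Poly_Mapping.single m (lookup p m)) \<in> ideal.span ((\<lambda>j. variable j ^ n) ` T)"
  proof (rule ideal.span_sum)
    fix m assume "m \<in> keys p"
    then obtain j where j: "j \<in> T" "n \<le> lookup m j" using p by blast
    have "m - Poly_Mapping.single j n + Poly_Mapping.single j n = m"
      using j(2) by (intro poly_mapping_eqI) (auto simp: Poly_Mapping.lookup_add lookup_minus lookup_single when_def)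
    then have "Poly_Mapping.single m (lookup p m) =
        Poly_Mapping.single (m - Poly_Mapping.single j n) (lookup p m) * variable j ^ n"
      by (simp add: variable_power mult_single)
    then show "Poly_Mapping.single m (lookup p m) \<in> ideal.span ((\<lambda>j. variable j ^ n) ` T)"
      using j(1) by (simp add: ideal.span_scale ideal.span_base)
  qed
  then show "p \<in> ideal.span ((\<lambda>j. variable j ^ n) ` T)" by (simp flip: sum_of_terms)
qed

text \<open>
  Multiplying by a power of another variable does not change the exponents of the variables in \<open>T\<close>.
\<close>

lemma variable_power_regular:
  assumes "i \<notin> T" "variable i ^ n * p \<in> ideal.span ((\<lambda>j. variable j ^ n) ` T)"
  shows "p \<in> ideal.span ((\<lambda>j. variable j ^ n) ` T)"
  unfolding in_monomial_ideal_iff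
proof
  fix m assume "m \<in> keys p"
  then have "Poly_Mapping.single i n + m \<in> keys (variable i ^ n * p)"
    by (simp add: in_keys_iff variable_power lookup_single_times)
  then obtain j where "j \<in> T" "n \<le> lookup (Poly_Mapping.single i n + m) j"
    using assms(2) unfolding in_monomial_ideal_iff by blast
  moreover have "i \<noteq> j" using assms(1) \<open>j \<in> T\<close> by blast
  ultimately show "\<exists>j\<in>T. n \<le> lookup m j"
    by (intro bexI[of _ j]) (auto simp: Poly_Mapping.lookup_add lookup_single_not_eq)
qed

text \<open>
  A common exponent for the four variables turns their powers into a regular sequence in the ideal.
\<close>

lemma syzygy_in_ideal:
  fixes a :: "quat_poly ^ 4"
  assumes pow: "\<And>j. \<exists>n. variable j ^ n \<in> ideal.span (range F)"
    and a: "(\<Sum>i\<in>UNIV. a $ i * F i) = 0"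
  shows "a $ k \<in> ideal.span (range F)"
proof -
  obtain e where e: "\<And>j. variable j ^ e j \<in> ideal.span (range F)" using pow by metis
  define n where "n = (\<Sum>j\<in>UNIV. e j)"
  have n: "variable j ^ n \<in> ideal.span (range F)" for j
  proof -
    have "e j \<le> n" unfolding n_def by (rule member_le_sum) auto
    then have "variable j ^ n = variable j ^ (n - e j) * variable j ^ e j" by (simp flip: power_add)
    then show ?thesis using e by (simp add: ideal.span_scale)
  qed
  obtain c where c: "\<And>j. variable j ^ n = (\<Sum>i\<in>UNIV. c j $ i * F i)"
    using n unfolding in_ideal_span_range by metis
  let ?F = "\<chi> i. F i"
  have r: "range (($) ?F) = range F" by auto
  have "a $ k \<in> ideal.span (range (($) ?F))"
  proof (rule koszul_unwinding[of _ "c 1" _ _ "c 2" _ "c 3" _ "c 4"])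
    show "variable 1 ^ n = (\<Sum>i\<in>UNIV. c 1 $ i * ?F $ i)" "variable 2 ^ n = (\<Sum>i\<in>UNIV. c 2 $ i * ?F $ i)"
      "variable 3 ^ n = (\<Sum>i\<in>UNIV. c 3 $ i * ?F $ i)" "variable 4 ^ n = (\<Sum>i\<in>UNIV. c 4 $ i * ?F $ i)"
      by (simp_all add: c)
    show "(\<Sum>i\<in>UNIV. a $ i * ?F $ i) = 0" using a by simp
    have "lookup (variable 1 ^ n) (Poly_Mapping.single 1 n) \<noteq> 0" by (simp add: variable_power)
    then show "variable 1 ^ n \<noteq> 0" by (metis lookup_zero)
  next
    fix p
    show "variable 2 ^ n * p \<in> ideal.span {variable 1 ^ n} \<Longrightarrow> p \<in> ideal.span {variable 1 ^ n}"
      using variable_power_regular[of 2 "{1}" n p] by simp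
    show "variable 3 ^ n * p \<in> ideal.span {variable 2 ^ n, variable 1 ^ n} \<Longrightarrow> p \<in> ideal.span {variable 2 ^ n, variable 1 ^ n}"
      using variable_power_regular[of 3 "{2, 1}" n p] by simp
    show "variable 4 ^ n * p \<in> ideal.span {variable 3 ^ n, variable 2 ^ n, variable 1 ^ n}
        \<Longrightarrow> p \<in> ideal.span {variable 3 ^ n, variable 2 ^ n, variable 1 ^ n}"
      using variable_power_regular[of 4 "{3, 2, 1}" n p] by simp
  qed
  then show ?thesis unfolding r .
qed

section \<open>Zeros of proper ideals\<close>

lemma eval_add: "eval_at (p + q) v = eval_at p v + eval_at q v"
  unfolding eval_at_def substitute_def
  by (rule sum_keys_additive[where g = "\<lambda>m c. c * (\<Prod>i\<in>UNIV. v $ i ^ lookup m i)"])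
    (simp_all add: distrib_right)

lemma eval_single: "eval_at (Poly_Mapping.single m c) v = c * (\<Prod>i\<in>UNIV. v $ i ^ lookup m i)"
  by (simp add: eval_at_def substitute_def)

lemma eval_0 [simp]: "eval_at 0 v = 0"
  by (simp add: eval_at_def substitute_def)

lemma eval_mult: "eval_at (p * q) v = eval_at p v * eval_at q v"
proof (induction p rule: additive_induct)
  case (single m c)
  show ?case
    by (induction q rule: additive_induct)
      (simp_all add: mult_single eval_single Poly_Mapping.lookup_add power_add prod.distrib eval_add distrib_left)
qed (simp_all add: eval_add distrib_right)

lemma eval_const [simp]: "eval_at (const c) v = c"
  by (simp add: const_def eval_single)

lemma eval_variable [simp]: "eval_at (variable i) v = v $ i"
proof -
  have "(\<Prod>j\<in>UNIV. v $ j ^ lookup (Poly_Mapping.single i (1::nat)) j) = (\<Prod>j\<in>UNIV. if i = j then v $ j else 1)"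
    by (intro prod.cong refl) (auto simp: lookup_single)
  then show ?thesis by (simp add: variable_def eval_single)
qed

lemma eval_sum: "eval_at (sum g A) v = (\<Sum>a\<in>A. eval_at (g a) v)"
  by (induction A rule: infinite_finite_induct) (auto simp: eval_add)

definition aeval :: "quat_poly \<Rightarrow> complex poly \<Rightarrow> quat_poly" where
  "aeval t P = poly (map_poly const P) t"

lemma const_0 [simp]: "const 0 = 0"
  by (simp add: const_def)

lemma aeval_0 [simp]: "aeval t 0 = 0"
  by (simp add: aeval_def)

lemma aeval_pCons [simp]: "aeval t (pCons c P) = const c + t * aeval t P"
  by (simp add: aeval_def map_poly_pCons)

lemma aeval_add: "aeval t (P + Q) = aeval t P + aeval t Q"
  by (induction P Q rule: poly_induct2) (simp_all add: const_add distrib_left)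

lemma aeval_smult: "aeval t (smult c P) = const c * aeval t P"
  by (induction P) (simp_all add: const_mult algebra_simps del: ideal.scale_scale)

lemma aeval_mult: "aeval t (P * Q) = aeval t P * aeval t Q"
  by (induction P) (simp_all add: aeval_add aeval_smult distrib_right)

lemma aeval_sum: "aeval t (sum g A) = (\<Sum>a\<in>A. aeval t (g a))"
  by (induction A rule: infinite_finite_induct) (auto simp: aeval_add)

lemma aeval_prod: "aeval t (prod g A) = (\<Prod>a\<in>A. aeval t (g a))"
  by (induction A rule: infinite_finite_induct) (auto simp: aeval_mult one_pCons)

text \<open>
  Over \<open>\<complex>\<close> the polynomial splits into linear factors, and a product of units modulo \<open>I\<close> is a unit
  modulo \<open>I\<close>.
\<close>

lemma aeval_notin_ideal:
  assumes I: "ideal.subspace I" "1 \<notin> I" and unit: "\<And>l. \<exists>b. b * (t - const l) - 1 \<in> I"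
    and "P \<noteq> 0"
  shows "aeval t P \<notin> I"
  using \<open>P \<noteq> 0\<close>
proof (induction "degree P" arbitrary: P)
  case 0
  then obtain c where c: "P = [:c:]" "c \<noteq> 0" by (metis degree_eq_zeroE pCons_0_0)
  show ?case
  proof
    assume "aeval t P \<in> I"
    then have "const (inverse c) * const c \<in> I" using c I ideal.subspace_scale by fastforce
    then show False using c I(2) by (simp flip: const_mult)
  qed
next
  case (Suc n)
  then obtain l where "poly P l = 0"
    using fundamental_theorem_of_algebra[of P] constant_degree[of P] by auto
  then obtain R where R: "P = [:- l, 1:] * R" by (auto simp: poly_eq_0_iff_dvd elim: dvdE)
  with Suc(3) have "R \<noteq> 0" by auto
  have "degree P = Suc (degree R)" unfolding R using \<open>R \<noteq> 0\<close> by (subst degree_mult_eq) auto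
  with Suc have IH: "aeval t R \<notin> I" using \<open>R \<noteq> 0\<close> by auto
  obtain b where b: "b * (t - const l) - 1 \<in> I" using unit by blast
  have "const (- l) = - const l" by (simp add: const_def single_uminus)
  then have eq: "aeval t P = (t - const l) * aeval t R"
    unfolding R aeval_mult by simp
  show ?case
  proof
    assume "aeval t P \<in> I"
    have "b * aeval t P - aeval t R * (b * (t - const l) - 1) \<in> I"
      using \<open>aeval t P \<in> I\<close> b by (rule ideal.subspace_diff[OF I(1) ideal.subspace_scale[OF I(1)] ideal.subspace_scale[OF I(1)]])
    moreover have "b * aeval t P - aeval t R * (b * (t - const l) - 1) = aeval t R"
      unfolding eq by (simp add: algebra_simps del: ideal.scale_scale)
    ultimately show False using IH by simp
  qed
qed

lemma bounded_degree_finite_dim: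
  "\<exists>B. finite B \<and> {p. \<forall>k>n. homog_part k p = 0} \<subseteq> CS.span B"
proof (intro exI conjI subsetI)
  let ?A = "\<Union>k\<le>n. {m. mon_degree m = k}"
  show "finite ((\<lambda>m. Poly_Mapping.single m (1::complex)) ` ?A)"
    by (intro finite_imageI finite_UN_I card_monomials) auto
  fix p assume p: "p \<in> {p. \<forall>k>n. homog_part k p = 0}"
  have "cscale (lookup p m) (Poly_Mapping.single m 1) \<in> CS.span ((\<lambda>m. Poly_Mapping.single m 1) ` ?A)"
    if "m \<in> keys p" for m
  proof -
    have "lookup (homog_part (mon_degree m) p) m \<noteq> 0" using that by (simp add: lookup_homog_part in_keys_iff)
    then have "homog_part (mon_degree m) p \<noteq> 0" by auto
    then have "m \<in> ?A" using p by (auto simp: not_less[symmetric])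
    then show ?thesis by (intro CS.span_scale CS.span_base imageI)
  qed
  then have "(\<Sum>m\<in>keys p. Poly_Mapping.single m (lookup p m)) \<in> CS.span ((\<lambda>m. Poly_Mapping.single m 1) ` ?A)"
    by (intro CS.span_sum) simp
  then show "p \<in> CS.span ((\<lambda>m. Poly_Mapping.single m 1) ` ?A)" by (simp flip: sum_of_terms)
qed

text \<open>
  The residue \<open>t\<close> takes some value \<open>l\<close>, in the sense that \<open>t - l\<close> is not a unit modulo \<open>I\<close>. Otherwise
  there are inverses \<open>b l\<close> for uncountably many \<open>l\<close>. Since \<open>S\<close> is a countable union of spaces of
  finite dimension, finitely many of the \<open>b l\<close> are linearly dependent; clearing denominators
  in the relation gives a nonzero polynomial in \<open>t\<close> that lies in \<open>I\<close>.
\<close>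

lemma exists_value_mod_ideal:
  assumes I: "ideal.subspace I" "1 \<notin> I"
  shows "\<exists>l. \<forall>b. b * (t - const l) - 1 \<notin> I"
proof (rule ccontr)
  assume "\<not> ?thesis"
  then have unit: "\<And>l. \<exists>b. b * (t - const l) - 1 \<in> I" by blast
  then obtain b where b: "\<And>l. b l * (t - const l) - 1 \<in> I" by metis
  \<comment> \<open>From \<open>b l = b l'\<close> the difference of the two inverse relations makes \<open>b l\<close> vanish modulo \<open>I\<close>.\<close>
  have inj: "inj b"
  proof (rule injI, rule ccontr)
    fix l l' assume eq: "b l = b l'" and "l \<noteq> l'"
    have c: "const (inverse (l' - l)) * (const l' - const l) = 1"
    proof -
      have "const l' - const l = const (l' - l)" by (simp add: const_def single_diff)
      then show ?thesis using \<open>l \<noteq> l'\<close> by (simp flip: const_mult)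
    qed
    have d: "(b l * (t - const l) - 1) - (b l' * (t - const l') - 1) \<in> I"
      by (rule ideal.subspace_diff[OF I(1) b b])
    have "(const (inverse (l' - l)) * (t - const l)) * ((b l * (t - const l) - 1) - (b l' * (t - const l') - 1))
        - (b l * (t - const l) - 1) \<in> I"
      by (rule ideal.subspace_diff[OF I(1) ideal.subspace_scale[OF I(1) d] b])
    moreover have "(const (inverse (l' - l)) * (t - const l)) * ((b l * (t - const l) - 1) - (b l' * (t - const l') - 1))
        - (b l * (t - const l) - 1) = 1"
      using c unfolding eq by algebra
    ultimately have "1 \<in> I" by (simp only:)
    with I(2) show False ..
  qed
  have "\<exists>n. infinite {l. \<forall>k>n. homog_part k (b l) = 0}"
  proof (rule ccontr)
    assume "\<not> ?thesis"
    then have "countable (\<Union>n. {l. \<forall>k>n. homog_part k (b l) = 0})"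
      by (intro countable_UN) (auto intro: countable_finite)
    moreover have "(\<Union>n. {l. \<forall>k>n. homog_part k (b l) = 0}) = UNIV" using homog_part_bounded by auto
    ultimately show False using uncountable_UNIV_complex by simp
  qed
  then obtain n where n: "infinite {l. \<forall>k>n. homog_part k (b l) = 0}" ..
  obtain B where B: "finite B" "{p. \<forall>k>n. homog_part k p = 0} \<subseteq> CS.span B"
    using bounded_degree_finite_dim by blast
  obtain L where L: "L \<subseteq> {l. \<forall>k>n. homog_part k (b l) = 0}" "finite L" "card L = Suc (card B)"
    using infinite_arbitrarily_large[OF n] by blast
  have "b ` L \<subseteq> CS.span B" using L(1) B(2) by blast
  moreover have cardL: "card (b ` L) = Suc (card B)"
    using L(3) card_image[OF inj_on_subset[OF inj]] by simp
  ultimately have "CS.dependent (b ` L)"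
    using CS.independent_span_bound[OF B(1), of "b ` L"] by fastforce
  then obtain u where u: "\<exists>v\<in>b ` L. u v \<noteq> 0" "(\<Sum>v\<in>b ` L. cscale (u v) v) = 0"
    using CS.dependent_finite[of "b ` L"] L(2) by auto
  define \<mu> where "\<mu> l = u (b l)" for l
  have rel: "(\<Sum>l\<in>L. const (\<mu> l) * b l) = 0"
    using u(2) sum.reindex[OF inj_on_subset[OF inj], of L "\<lambda>v. cscale (u v) v"]
    by (simp add: \<mu>_def cscale_def)
  obtain l0 where l0: "l0 \<in> L" "\<mu> l0 \<noteq> 0" using u(1) by (auto simp: \<mu>_def)
  define Q where "Q = (\<Sum>l\<in>L. smult (\<mu> l) (\<Prod>l'\<in>L - {l}. [:- l', 1:]))"
  have "poly Q l0 = (\<Sum>l\<in>L. if l = l0 then \<mu> l0 * (\<Prod>l'\<in>L - {l0}. l0 - l') else 0)"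
    unfolding Q_def poly_sum
    by (intro sum.cong refl) (use L(2) l0 in \<open>auto simp: poly_prod prod_zero_iff\<close>)
  also have "\<dots> \<noteq> 0" using l0 L(2) by simp
  finally have "Q \<noteq> 0" by auto
  let ?P = "\<lambda>l. \<Prod>l'\<in>L - {l}. t - const l'"
  have "const (- l) = - const l" for l by (simp add: const_def single_uminus)
  then have "aeval t Q = (\<Sum>l\<in>L. const (\<mu> l) * ?P l)"
    by (simp add: Q_def aeval_sum aeval_smult aeval_prod)
  \<comment> \<open>Subtract the full product times the linear relation, which is zero.\<close>
  also have "\<dots> = (\<Sum>l\<in>L. const (\<mu> l) * ?P l) - (\<Prod>l'\<in>L. t - const l') * (\<Sum>l\<in>L. const (\<mu> l) * b l)"
    by (simp add: rel)
  also have "\<dots> = (\<Sum>l\<in>L. (- const (\<mu> l) * ?P l) * (b l * (t - const l) - 1))"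
    unfolding sum_distrib_left sum_subtractf[symmetric]
  proof (intro sum.cong refl)
    fix l assume "l \<in> L"
    then have "(\<Prod>l'\<in>L. t - const l') = (t - const l) * ?P l" using L(2) by (simp add: prod.remove)
    then show "const (\<mu> l) * ?P l - (\<Prod>l'\<in>L. t - const l') * (const (\<mu> l) * b l)
        = (- const (\<mu> l) * ?P l) * (b l * (t - const l) - 1)"
      by algebra
  qed
  also have "\<dots> \<in> I"
    using I(1) b by (intro ideal.subspace_sum ideal.subspace_scale)
  finally show False using aeval_notin_ideal[OF I unit \<open>Q \<noteq> 0\<close>] by blast
qed

lemma extend_proper_ideal:
  assumes I: "ideal.subspace I" "1 \<notin> I"
  obtains l I' where "ideal.subspace I'" "1 \<notin> I'" "I \<subseteq> I'" "t - const l \<in> I'"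
proof -
  obtain l where l: "\<And>b. b * (t - const l) - 1 \<notin> I" using exists_value_mod_ideal[OF I] by blast
  let ?I = "ideal.span (insert (t - const l) I)"
  have spI: "ideal.span I = I" using I(1) by simp
  show thesis
  proof (rule that)
    show "1 \<notin> ?I"
    proof
      assume "1 \<in> ?I"
      then obtain k where "1 - k * (t - const l) \<in> I"
        unfolding in_span_insert_iff spI by blast
      then have "- (1 - k * (t - const l)) \<in> I" using I(1) by (rule ideal.subspace_neg[rotated])
      then show False using l[of k] by simp
    qed
  qed (auto intro: ideal.span_base)
qed

lemma monomial_as_product:
  "Poly_Mapping.single m c = const c * (\<Prod>i\<in>UNIV. variable i ^ lookup m i)"
proof -
  have "(\<Prod>i\<in>A. variable i ^ lookup m i) = Poly_Mapping.single (\<Sum>i\<in>A. Poly_Mapping.single i (lookup m i)) 1" for A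
    by (induction A rule: infinite_finite_induct) (simp_all add: variable_power mult_single)
  moreover have "(\<Sum>i\<in>UNIV. Poly_Mapping.single i (lookup m i)) = m"
    by (rule poly_mapping_eqI) (simp add: lookup_sum lookup_single when_def)
  ultimately show ?thesis by (simp add: const_def mult_single)
qed

text \<open>
  The weak Nullstellensatz. Adjoining \<open>x\<^sub>j - l\<^sub>j\<close> for one variable after the other keeps the ideal
  proper; then each \<open>p\<close> is congruent to its value at \<open>(l\<^sub>1, l\<^sub>2, l\<^sub>3, l\<^sub>4)\<close>, which must vanish on \<open>I\<close>.
\<close>

lemma zero_of_proper_ideal:
  assumes I: "ideal.subspace I" "1 \<notin> I"
  obtains v where "\<And>p. p \<in> I \<Longrightarrow> eval_at p v = 0"
proof -
  obtain l1 I1 where 1: "ideal.subspace I1" "1 \<notin> I1" "I \<subseteq> I1" "variable 1 - const l1 \<in> I1"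
    using extend_proper_ideal[OF I] by metis
  obtain l2 I2 where 2: "ideal.subspace I2" "1 \<notin> I2" "I1 \<subseteq> I2" "variable 2 - const l2 \<in> I2"
    using extend_proper_ideal[OF 1(1,2)] by metis
  obtain l3 I3 where 3: "ideal.subspace I3" "1 \<notin> I3" "I2 \<subseteq> I3" "variable 3 - const l3 \<in> I3"
    using extend_proper_ideal[OF 2(1,2)] by metis
  obtain l4 M where 4: "ideal.subspace M" "1 \<notin> M" "I3 \<subseteq> M" "variable 4 - const l4 \<in> M"
    using extend_proper_ideal[OF 3(1,2)] by metis
  define v :: "complex ^ 4" where "v = (\<chi> i. if i = 1 then l1 else if i = 2 then l2 else if i = 3 then l3 else l4)"
  have var: "variable i - const (eval_at (variable i) v) \<in> M" for i
  proof -
    have "\<forall>i. variable i - const (v $ i) \<in> M"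
      unfolding forall_4 using 1 2 3 4 by (auto simp: v_def)
    then show ?thesis by simp
  qed
  have mult: "p * q - const (eval_at (p * q) v) \<in> M"
    if "p - const (eval_at p v) \<in> M" "q - const (eval_at q v) \<in> M" for p q
  proof -
    have "p * q - const (eval_at (p * q) v)
        = p * (q - const (eval_at q v)) + const (eval_at q v) * (p - const (eval_at p v))"
      unfolding eval_mult const_mult by algebra
    also have "\<dots> \<in> M" using 4(1) that by (intro ideal.subspace_add ideal.subspace_scale)
    finally show ?thesis .
  qed
  have one: "1 - const (eval_at 1 v) \<in> M"
    using ideal.subspace_0[OF 4(1)] eval_const[of 1 v] by simp
  have pow: "variable i ^ n - const (eval_at (variable i ^ n) v) \<in> M" for i n
    by (induction n) (use one var mult in \<open>auto simp del: eval_variable\<close>)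
  have prod: "(\<Prod>i\<in>A. variable i ^ e i) - const (eval_at (\<Prod>i\<in>A. variable i ^ e i) v) \<in> M" for A e
    by (induction A rule: infinite_finite_induct) (use one pow mult in auto)
  have all: "p - const (eval_at p v) \<in> M" for p
  proof (induction p rule: additive_induct)
    case zero
    show ?case using ideal.subspace_0[OF 4(1)] by simp
  next
    case (single m c)
    have "const c - const (eval_at (const c) v) \<in> M" using ideal.subspace_0[OF 4(1)] by simp
    then show ?case unfolding monomial_as_product[of m c] using prod by (rule mult)
  next
    case (add p q)
    have "p + q - const (eval_at (p + q) v) = (p - const (eval_at p v)) + (q - const (eval_at q v))"
      by (simp add: eval_add const_add)
    then show ?case using ideal.subspace_add[OF 4(1) add] by (simp only:)
  qed
  show thesis
  proof (rule that, rule ccontr)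
    fix p assume p: "p \<in> I" and nz: "eval_at p v \<noteq> 0"
    have "p \<in> M" using p 1 2 3 4 by blast
    then have "p - (p - const (eval_at p v)) \<in> M" using 4(1) all ideal.subspace_diff by blast
    then have "const (inverse (eval_at p v)) * const (eval_at p v) \<in> M"
      using ideal.subspace_scale[OF 4(1)] by simp
    then show False using 4(2) nz by (simp flip: const_mult)
  qed
qed

text \<open>
  A zero of the ideal \<open>(F) + (x\<^sub>j - 1)\<close> would be a common zero of \<open>F\<close> other than the origin, so
  \<open>1 \<equiv> k (x\<^sub>j - 1)\<close> modulo \<open>(F)\<close> for some \<open>k\<close>. Comparing components, the part of \<open>k\<close> in degree \<open>n\<close> is
  congruent to \<open>- x\<^sub>j\<^sup>n\<close>, and it vanishes for large \<open>n\<close>.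
\<close>

lemma variable_power_in_ideal:
  fixes F :: "4 \<Rightarrow> quat_poly"
  assumes F: "\<And>i. homogeneous e (F i)"
    and nz: "\<And>v. v \<noteq> 0 \<Longrightarrow> \<exists>i. eval_at (F i) v \<noteq> 0"
  shows "\<exists>n. variable j ^ n \<in> ideal.span (range F)"
proof -
  let ?J = "ideal.span (range F)"
  let ?I = "ideal.span (insert (variable j - 1) (range F))"
  have "1 \<in> ?I"
  proof (rule ccontr)
    assume "1 \<notin> ?I"
    then obtain v where v: "\<And>p. p \<in> ?I \<Longrightarrow> eval_at p v = 0"
      using zero_of_proper_ideal[OF ideal.subspace_span] by blast
    have "eval_at (variable j - const 1) v = 0" using v by (simp add: ideal.span_base)
    then have "v $ j = 1"
      using eval_add[of "variable j - const 1" "const 1" v] by (simp del: const_1)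
    then have "v \<noteq> 0" by auto
    then obtain i where "eval_at (F i) v \<noteq> 0" using nz by blast
    then show False using v[of "F i"] by (simp add: ideal.span_base)
  qed
  then obtain k where k: "1 - k * (variable j - 1) \<in> ?J" unfolding in_span_insert_iff by blast
  have part_in_J: "homog_part n x \<in> ?J" if x: "x \<in> ?J" for x n
  proof -
    obtain a :: "quat_poly ^ 4" where "x = (\<Sum>i\<in>UNIV. a $ i * F i)"
      using x in_ideal_span_range[of x F] by blast
    then have "homog_part n x = (if e \<le> n then \<Sum>i\<in>UNIV. (\<chi> i. homog_part (n - e) (a $ i)) $ i * F i else 0)"
      using homog_part_combination[of e F, OF F] by simp
    then show ?thesis by (simp add: ideal.span_sum ideal.span_scale ideal.span_base ideal.span_zero)
  qed
  have eq: "1 - k * (variable j - 1) = 1 + k - k * variable j" by algebra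
  have one: "homogeneous 0 (1 :: quat_poly)" by (simp add: homogeneous_def)
  have ind: "variable j ^ n + homog_part n k \<in> ?J" for n
  proof (induction n)
    case 0
    have "homog_part 0 (1 + k - k * variable j) \<in> ?J" using k unfolding eq by (rule part_in_J)
    then show ?case
      by (simp add: homog_part_add homog_part_diff homog_part_homogeneous[OF one] homog_part_mult_homogeneous[OF homogeneous_variable])
  next
    case (Suc n)
    have "homog_part (Suc n) (1 + k - k * variable j) \<in> ?J" using k unfolding eq by (rule part_in_J)
    then have "homog_part (Suc n) k - homog_part n k * variable j \<in> ?J"
      by (simp add: homog_part_add homog_part_diff homog_part_homogeneous[OF one] homog_part_mult_homogeneous[OF homogeneous_variable])
    moreover have "variable j * (variable j ^ n + homog_part n k) \<in> ?J" using Suc by (rule ideal.span_scale)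
    ultimately have "(homog_part (Suc n) k - homog_part n k * variable j) + variable j * (variable j ^ n + homog_part n k) \<in> ?J"
      by (rule ideal.span_add)
    moreover have "(homog_part (Suc n) k - homog_part n k * variable j) + variable j * (variable j ^ n + homog_part n k)
        = variable j ^ Suc n + homog_part (Suc n) k"
      unfolding power_Suc by algebra
    ultimately show ?case by simp
  qed
  obtain n where "\<And>m. m > n \<Longrightarrow> homog_part m k = 0" using homog_part_bounded by blast
  then have "variable j ^ Suc n \<in> ?J" using ind[of "Suc n"] by simp
  then show ?thesis by (rule exI)
qed

section \<open>Numerical invariants\<close>

lemma partial_of_degree_0: "homogeneous 0 f \<Longrightarrow> partial i f = 0"
  using exists_homog_part[of "partial i f"] homog_part_homogeneous[of 0 f] by (auto simp: homog_part_partial when_def)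

text \<open>
  A form of degree zero has every vector as a syzygy, also in degree zero, where the exponents
  allow none.
\<close>

lemma exponents_degree_pos:
  assumes "homogeneous d f" "free_with_exponents f d1 d2 d3" "1 \<le> d1" "d1 \<le> d2" "d2 \<le> d3"
  shows "d \<ge> 1"
proof (rule ccontr)
  assume "\<not> d \<ge> 1"
  then have "d = 0" by simp
  then have "homogeneous 0 f" using assms(1) by simp
  then have "AR f = UNIV" by (auto simp: AR_def partial_of_degree_0)
  then show False
    using dim_syzygies_free[OF assms(2), of 0] dim_homogeneous_vec(1)[of 0] assms(3-5) by simp
qed

text \<open>
  By Euler's formula a common zero of the partial derivatives lies on the surface, so smoothness
  leaves only the origin.
\<close>

lemma syzygies_low_degree_0:
  assumes "smooth_surface f" "homogeneous d f" "d \<ge> 1" "a \<in> AR f" "homogeneous_vec q a" "q < d - 1"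
  shows "a = 0"
proof -
  have F: "homogeneous (d - 1) (partial i f)" for i by (rule homogeneous_partial[OF assms(2)])
  have nz: "\<exists>i. eval_at (partial i f) v \<noteq> 0" if "v \<noteq> 0" for v
  proof (rule ccontr)
    assume *: "\<nexists>i. eval_at (partial i f) v \<noteq> 0"
    have "of_nat d = const (of_nat d)" by (simp add: const_def)
    then have "of_nat d * eval_at f v = eval_at (of_nat d * f) v" by (simp add: eval_mult)
    also have "\<dots> = 0"
      unfolding euler[OF assms(2), symmetric] using * by (simp add: eval_sum eval_mult)
    finally have "eval_at f v = 0" using assms(3) by simp
    with assms(1) that * show False unfolding smooth_surface_def by blast
  qed
  have "a $ i = 0" for i
  proof (rule ideal_low_degree[of "d - 1" "\<lambda>i. partial i f", OF F _ _ assms(6)])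
    show "a $ i \<in> ideal.span (range (\<lambda>i. partial i f))"
      using assms(4) variable_power_in_ideal[of "d - 1" "\<lambda>i. partial i f", OF F nz]
      by (intro syzygy_in_ideal) (auto simp: AR_def)
    show "homogeneous q (a $ i)" using assms(5) by (simp add: homogeneous_vec_def)
  qed
  then show ?thesis by (simp add: vec_eq_iff)
qed

text \<open>
  The number of monomials of degree \<open>n\<close>, as a function on all integers.
\<close>

definition trunc_binom :: "int \<Rightarrow> real" where
  "trunc_binom n = (if n \<ge> 0 then real ((nat n + 3) choose 3) else 0)"

definition poly_binom :: "real \<Rightarrow> real" where
  "poly_binom x = (x + 1) * (x + 2) * (x + 3) / 6"

text \<open>
  The cubic vanishes at \<open>-1\<close>, \<open>-2\<close>, \<open>-3\<close> and equals \<open>-1\<close> at \<open>-4\<close>; the latter is the source of the value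
  of \<open>st\<close>.
\<close>

lemma trunc_binom_eq:
  assumes "n \<ge> -4"
  shows "trunc_binom n = poly_binom (real_of_int n) + (if n = -4 then 1 else 0)"
proof (cases "n \<ge> 0")
  case True
  define m where "m = nat n"
  have n: "n = int m" using True by (simp add: m_def)
  have "real ((m + 3) choose 3) = poly_binom (real m)"
    using binomial_gbinomial[of "m + 3" 3, where ?'a = real]
    by (simp add: poly_binom_def gbinomial_prod_rev numeral_3_eq_3 algebra_simps)
  then show ?thesis using n by (simp add: trunc_binom_def)
next
  case False
  then have "n = -1 \<or> n = -2 \<or> n = -3 \<or> n = -4" using assms by linarith
  then show ?thesis by (auto simp: trunc_binom_def poly_binom_def)
qed

lemma hilbert_fun_trunc:
  assumes "homogeneous d f" "d \<ge> 1"
  shows "real (hilbert_fun f k) = trunc_binom (int k) - 4 * trunc_binom (int k - (int d - 1))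
    + (if d - 1 \<le> k then real (V4.dim {a \<in> AR f. homogeneous_vec (k - (d - 1)) a}) else 0)"
proof -
  have n: "nat (int k - (int d - 1)) = k - (d - 1)" "int k - (int d - 1) \<ge> 0 \<longleftrightarrow> d - 1 \<le> k"
    using assms(2) by auto
  have "real (hilbert_fun f k) + real (if d - 1 \<le> k then 4 * ((k - (d - 1) + 3) choose 3) else 0)
    = real ((k + 3) choose 3) + real (if d - 1 \<le> k then V4.dim {a \<in> AR f. homogeneous_vec (k - (d - 1)) a} else 0)"
    unfolding of_nat_add[symmetric] of_nat_eq_iff by (rule hilbert_fun_plus[OF assms(1)])
  then show ?thesis
    unfolding trunc_binom_def n by (auto split: if_splits)
qed

lemma hilbert_fun_free:
  assumes "homogeneous d f" "d \<ge> 1" "free_with_exponents f d1 d2 d3"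
  shows "real (hilbert_fun f k) = trunc_binom (int k) - 4 * trunc_binom (int k - (int d - 1))
    + trunc_binom (int k - (int d - 1) - int d1) + trunc_binom (int k - (int d - 1) - int d2)
    + trunc_binom (int k - (int d - 1) - int d3)"
proof -
  have t: "trunc_binom (int k - (int d - 1) - int e) =
      (if d - 1 \<le> k then real (if e \<le> k - (d - 1) then (k - (d - 1) - e + 3) choose 3 else 0) else 0)" for e
  proof -
    have "nat (int k - (int d - 1) - int e) = k - (d - 1) - e" using assms(2) by auto
    moreover have "int k - (int d - 1) - int e \<ge> 0 \<longleftrightarrow> d - 1 \<le> k \<and> e \<le> k - (d - 1)"
      using assms(2) by auto
    ultimately show ?thesis by (simp add: trunc_binom_def)
  qed
  show ?thesis
    unfolding hilbert_fun_trunc[OF assms(1,2)] dim_syzygies_free[OF assms(3)] t by simp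
qed

text \<open>
  The inequality not covered by \<open>degree_le_sum_exponents\<close> comes from growth: for large \<open>k\<close> the
  Hilbert function is a quadratic polynomial with leading coefficient half of
  \<open>(d - 1) - (d\<^sub>1 + d\<^sub>2 + d\<^sub>3)\<close>, and it takes no negative values.
\<close>

lemma sum_exponents:
  assumes f: "homogeneous d f" "squarefree f" and fr: "free_with_exponents f d1 d2 d3"
    and d: "1 \<le> d1" "d1 \<le> d2" "d2 \<le> d3"
  shows "d1 + d2 + d3 = d - 1"
proof -
  have d1: "d \<ge> 1" by (rule exponents_degree_pos[OF f(1) fr d])
  obtain a b c where abc: "homogeneous_vec d1 a" "homogeneous_vec d2 b" "homogeneous_vec d3 c"
    "\<And>p q r. p *s a + q *s b + r *s c = 0 \<Longrightarrow> p = 0 \<and> q = 0 \<and> r = 0"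
    "\<And>v. v \<in> AR f \<longleftrightarrow> (\<exists>p q r. v = p *s a + q *s b + r *s c)"
    using free_with_exponentsE[OF fr] by metis
  have "a = 1 *s a + 0 *s b + 0 *s c" "b = 0 *s a + 1 *s b + 0 *s c" "c = 0 *s a + 0 *s b + 1 *s c"
    by simp_all
  then have "a \<in> AR f" "b \<in> AR f" "c \<in> AR f" unfolding abc(5) by blast+
  then have ge: "d \<le> 1 + (d1 + d2 + d3)"
    using degree_le_sum_exponents[OF f d1 _ _ _ abc(1-4)] by blast
  define D where "D = real d - 1"
  define s where "s = real d1 + real d2 + real d3"
  define A where "A = (D - s) / 2"
  have "\<exists>B C. \<forall>x. poly_binom x - 4 * poly_binom (x - D) + poly_binom (x - D - real d1)
      + poly_binom (x - D - real d2) + poly_binom (x - D - real d3) = A * x ^ 2 + B * x + C"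
  proof -
    define q where "q x = poly_binom x - 4 * poly_binom (x - D) + poly_binom (x - D - real d1)
      + poly_binom (x - D - real d2) + poly_binom (x - D - real d3)" for x
    have "q x = A * x ^ 2 + (q 1 - q 0 - A) * x + q 0" for x
      unfolding q_def poly_binom_def A_def s_def by (simp add: field_simps) algebra
    then show ?thesis unfolding q_def by blast
  qed
  then obtain B C where q: "\<And>x. poly_binom x - 4 * poly_binom (x - D) + poly_binom (x - D - real d1)
      + poly_binom (x - D - real d2) + poly_binom (x - D - real d3) = A * x ^ 2 + B * x + C" by blast
  have "A \<ge> 0"
  proof (rule ccontr)
    assume "\<not> A \<ge> 0"
    obtain n where n: "real n > (\<bar>B\<bar> + \<bar>C\<bar>) / (- A)" using reals_Archimedean2 by blast
    \<comment> \<open>Large enough for all binomials to be polynomial and for the quadratic to be negative.\<close>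
    define k where "k = Suc n + (d + d3)"
    have k: "real k \<ge> 1" "real k > (\<bar>B\<bar> + \<bar>C\<bar>) / (- A)" using n by (auto simp: k_def)
    have "int k - (int d - 1) - int d3 \<ge> 0" by (simp add: k_def)
    then have "real (hilbert_fun f k) = A * real k ^ 2 + B * real k + C"
      unfolding hilbert_fun_free[OF f(1) d1 fr] q[symmetric]
      using d by (simp add: trunc_binom_eq D_def)
    then have nn: "A * real k ^ 2 + B * real k + C \<ge> 0" by (metis of_nat_0_le_iff)
    have "C \<le> \<bar>C\<bar> * real k" using k(1) by (meson abs_ge_self abs_ge_zero mult_le_cancel_left1 order_trans not_le)
    moreover have "B * real k \<le> \<bar>B\<bar> * real k" using k(1) by (intro mult_right_mono) auto
    ultimately have "A * real k ^ 2 + B * real k + C \<le> real k * (A * real k + (\<bar>B\<bar> + \<bar>C\<bar>))"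
      by (simp add: algebra_simps power2_eq_square)
    moreover have "A * real k + (\<bar>B\<bar> + \<bar>C\<bar>) < 0"
      using k(2) \<open>\<not> A \<ge> 0\<close> by (simp add: field_simps)
    ultimately have "A * real k ^ 2 + B * real k + C < 0"
      using k(1) mult_pos_neg[of "real k" "A * real k + (\<bar>B\<bar> + \<bar>C\<bar>)"] by linarith
    with nn show False by simp
  qed
  then have "d1 + d2 + d3 \<le> d - 1" unfolding A_def D_def s_def using d1 by simp
  with ge show ?thesis by simp
qed

lemma poly_eq_if_eventually_eq_on_nat:
  fixes P Q :: "real poly"
  assumes "\<forall>\<^sub>F k in sequentially. poly P (real k) = poly Q (real k)"
  shows "P = Q"
proof (rule ccontr)
  assume "P \<noteq> Q"
  then have "finite {x. poly (P - Q) x = 0}" by (intro poly_roots_finite) simp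
  moreover obtain K where "\<And>k. k \<ge> K \<Longrightarrow> poly P (real k) = poly Q (real k)"
    using assms unfolding eventually_sequentially by blast
  then have "real ` {K..} \<subseteq> {x. poly (P - Q) x = 0}" by auto
  ultimately have "finite (real ` {K..})" by (rule rev_finite_subset)
  then have "finite {K..}" by (rule finite_imageD) simp
  then show False using infinite_Ici by blast
qed

lemma hilbert_poly_eqI:
  assumes "\<And>k. k \<ge> K \<Longrightarrow> real (hilbert_fun f k) = poly P (real k)"
  shows "hilbert_poly f = P"
  unfolding hilbert_poly_def
proof (rule the_equality)
  show ev: "\<forall>\<^sub>F k in sequentially. real (hilbert_fun f k) = poly P (real k)"
    using assms unfolding eventually_sequentially by blast
  fix Q assume "\<forall>\<^sub>F k in sequentially. real (hilbert_fun f k) = poly Q (real k)"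
  with ev have "\<forall>\<^sub>F k in sequentially. poly Q (real k) = poly P (real k)"
    by eventually_elim simp
  then show "Q = P" by (rule poly_eq_if_eventually_eq_on_nat)
qed

text \<open>
  Koszul relations have no components in degrees below \<open>d - 1\<close>, so the first basis element is not
  among them.
\<close>

lemma mdr_free:
  assumes f: "homogeneous d f" and fr: "free_with_exponents f d1 d2 d3"
    and d: "d1 \<le> d2" "d2 \<le> d3" "d1 < d - 1"
  shows "mdr f = d1"
proof -
  obtain a b c where abc: "homogeneous_vec d1 a" "homogeneous_vec d2 b" "homogeneous_vec d3 c"
    "\<And>p q r. p *s a + q *s b + r *s c = 0 \<Longrightarrow> p = 0 \<and> q = 0 \<and> r = 0"
    "\<And>v. v \<in> AR f \<longleftrightarrow> (\<exists>p q r. v = p *s a + q *s b + r *s c)"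
    using free_with_exponentsE[OF fr] by metis
  let ?M = "{v :: quat_poly ^ 4. \<forall>i. \<forall>k<d - 1. homog_part k (v $ i) = 0}"
  have F: "homogeneous (d - 1) (partial i f)" for i by (rule homogeneous_partial[OF f])
  have KR: "KR f \<subseteq> ?M"
    unfolding KR_def
  proof (rule S4.span_minimal)
    show "{axis i (partial j f) - axis j (partial i f) |i j. True} \<subseteq> ?M"
      by (auto simp: axis_def homog_part_diff homog_part_homogeneous[OF F])
    show "S4.subspace ?M"
      by (auto simp: S4.subspace_def homog_part_add homog_part_mult)
  qed
  have "a \<noteq> 0" using abc(4)[of 1 0 0] by auto
  have "a \<notin> KR f"
  proof
    assume "a \<in> KR f"
    then have "homog_part d1 (a $ i) = 0" for i using KR d(3) by auto
    then have "a $ i = 0" for i using abc(1) by (simp add: homogeneous_vec_def homogeneous_iff_homog_part)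
    with \<open>a \<noteq> 0\<close> show False by (simp add: vec_eq_iff)
  qed
  moreover have "a = 1 *s a + 0 *s b + 0 *s c" by simp
  then have "a \<in> AR f" unfolding abc(5) by blast
  moreover have "d1 \<le> q" if v: "v \<in> AR f" "homogeneous_vec q v" "v \<notin> KR f" for q v
  proof (rule ccontr)
    assume q: "\<not> d1 \<le> q"
    obtain p r s where eq: "v = p *s a + r *s b + s *s c" using v(1) unfolding abc(5) by blast
    have "homog_part q (v $ i) = 0" for i
    proof -
      have h: "homogeneous d1 (a $ i)" "homogeneous d2 (b $ i)" "homogeneous d3 (c $ i)"
        using abc(1-3) by (simp_all add: homogeneous_vec_def)
      show ?thesis using q d unfolding eq by (simp add: homog_part_add homog_part_mult_homogeneous[OF h(1)]
          homog_part_mult_homogeneous[OF h(2)] homog_part_mult_homogeneous[OF h(3)])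
    qed
    then have "v = 0" using v(2) by (simp add: homogeneous_vec_def homogeneous_iff_homog_part vec_eq_iff)
    then show False using v(3) by (simp add: KR_def S4.span_zero)
  qed
  ultimately show ?thesis unfolding mdr_def using abc(1) by (intro Least_equality) blast+
qed

text \<open>
  Both Hilbert functions equal the contribution of \<open>S\<close> and of the four generators until the
  first basis syzygy of \<open>f\<close> contributes; the smooth form still has no syzygies there because
  \<open>d\<^sub>1 < d - 1\<close>.
\<close>

lemma ct_free:
  assumes f: "homogeneous d f" and fr: "free_with_exponents f d1 d2 d3"
    and fs: "homogeneous d fs" "smooth_surface fs"
    and d: "1 \<le> d1" "d1 \<le> d2" "d2 \<le> d3" "d1 < d - 1"
  shows "ct f fs = d1 + d - 2"
proof -
  have d1: "d \<ge> 1" using d by simp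
  have fs_eq: "real (hilbert_fun fs k) = trunc_binom (int k) - 4 * trunc_binom (int k - (int d - 1))"
    if "k \<le> d1 + (d - 1)" for k
  proof -
    have "V4.dim {a \<in> AR fs. homogeneous_vec (k - (d - 1)) a} = 0"
    proof -
      have "{a \<in> AR fs. homogeneous_vec (k - (d - 1)) a} \<subseteq> {0}"
        using syzygies_low_degree_0[OF fs(2,1) d1] that d(4) by auto
      then show ?thesis using V4.dim_le_card[of _ "{}"] by fastforce
    qed
    then show ?thesis unfolding hilbert_fun_trunc[OF fs(1) d1] by simp
  qed
  have t0: "trunc_binom (int k - (int d - 1) - int e) = 0" if "k < d1 + (d - 1)" "d1 \<le> e" for k e
    using that d1 by (simp add: trunc_binom_def)
  show ?thesis
    unfolding ct_def
  proof (rule Greatest_equality)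
    show "\<forall>k\<le>d1 + d - 2. hilbert_fun f k = hilbert_fun fs k"
    proof (intro allI impI)
      fix k assume "k \<le> d1 + d - 2"
      then have k: "k < d1 + (d - 1)" using d by simp
      have "real (hilbert_fun f k) = real (hilbert_fun fs k)"
        unfolding hilbert_fun_free[OF f d1 fr] using fs_eq[of k] t0[OF k] k d by simp
      then show "hilbert_fun f k = hilbert_fun fs k" by simp
    qed
  next
    fix q assume q: "\<forall>k\<le>q. hilbert_fun f k = hilbert_fun fs k"
    show "q \<le> d1 + d - 2"
    proof (rule ccontr)
      assume "\<not> q \<le> d1 + d - 2"
      then have "hilbert_fun f (d1 + (d - 1)) = hilbert_fun fs (d1 + (d - 1))"
        using q d by simp
      then have "trunc_binom (int (d1 + (d - 1)) - (int d - 1) - int d1)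
          + trunc_binom (int (d1 + (d - 1)) - (int d - 1) - int d2)
          + trunc_binom (int (d1 + (d - 1)) - (int d - 1) - int d3) = 0"
        using hilbert_fun_free[OF f d1 fr, of "d1 + (d - 1)"] fs_eq[of "d1 + (d - 1)"] by simp
      moreover have "trunc_binom (int (d1 + (d - 1)) - (int d - 1) - int d1) = 1"
        using d1 by (simp add: trunc_binom_def of_nat_diff)
      moreover have "trunc_binom n \<ge> 0" for n by (simp add: trunc_binom_def)
      ultimately show False by (smt (verit))
    qed
  qed
qed

theorem theorem4p7:
  fixes f :: quat_poly and d d1 d2 d3 :: nat
  assumes "homogeneous d f"
    and "squarefree f"
    and "\<not> is_cone f"
    and "1 \<le> d1" and "d1 \<le> d2" and "d2 \<le> d3"
    and "free_with_exponents f d1 d2 d3"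
  shows "(int d1 + int d2 + int d3 = int d - 1 \<and>
          mdr f = d1 \<and>
          (\<forall>fs. homogeneous d fs \<and> smooth_surface fs \<longrightarrow> int (ct f fs) = int d1 + int d - 2) \<and>
          int (st f) = int d + int d3 - 4) \<and>
         (let s1 = real d1 + real d2 + real d3;
              s2 = real d1 * real d2 + real d1 * real d3 + real d2 * real d3;
              s3 = real d1 * real d2 * real d3;
              a = s1^2 - s2;
              b = 2 * a - s1^3 + 3/2 * s1 * s2 - 1/2 * s3
          in \<forall>k. poly (hilbert_poly f) k = a * k + b)"
proof -
  note fr = assms(7) and f = assms(1) and d = assms(4-6)
  have sum: "d1 + d2 + d3 = d - 1" by (rule sum_exponents[OF assms(1,2,7,4,5,6)])
  then have D: "d = d1 + d2 + d3 + 1" "d \<ge> 1" "d1 < d - 1" using d by linarith+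
  define s1 s2 s3 where "s1 = real d1 + real d2 + real d3"
    and "s2 = real d1 * real d2 + real d1 * real d3 + real d2 * real d3"
    and "s3 = real d1 * real d2 * real d3"
  define a where "a = s1^2 - s2"
  define b where "b = 2 * a - s1^3 + 3/2 * s1 * s2 - 1/2 * s3"
  define delta where "delta n = (if n = (-4::int) then 1 else 0 :: real)" for n
  have P: "real (hilbert_fun f k) = (a * real k + b) + delta (int k - (int d - 1) - int d1)
      + delta (int k - (int d - 1) - int d2) + delta (int k - (int d - 1) - int d3)"
    if "int k \<ge> int d + int d3 - 5" for k
  proof -
    have lin: "poly_binom x - 4 * poly_binom (x - s1) + poly_binom (x - s1 - real d1)
        + poly_binom (x - s1 - real d2) + poly_binom (x - s1 - real d3) = a * x + b" for x
      unfolding poly_binom_def b_def a_def s1_def s2_def s3_def by (simp add: field_simps) algebra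
    have r: "real d - 1 = s1" by (simp add: D s1_def)
    have "trunc_binom (int k) = poly_binom (real k)" by (simp add: trunc_binom_eq)
    moreover have "trunc_binom (int k - (int d - 1)) = poly_binom (real k - s1)"
      using that d by (simp add: trunc_binom_eq r)
    moreover have "trunc_binom (int k - (int d - 1) - int e)
        = poly_binom (real k - s1 - real e) + delta (int k - (int d - 1) - int e)" if "e \<le> d3" for e
      using that \<open>int k \<ge> _\<close> by (simp add: trunc_binom_eq r delta_def)
    ultimately show ?thesis
      using d lin[of "real k"] unfolding hilbert_fun_free[OF f D(2) fr] by simp
  qed
  have P0: "real (hilbert_fun f k) = poly [:b, a:] (real k)" if "k \<ge> d + d3 - 4" for k
  proof -
    have k: "int k \<ge> int d + int d3 - 4" using that d D(1) by simp
    then have 0: "delta (int k - (int d - 1) - int e) = 0" if "e \<le> d3" for e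
      using that by (simp add: delta_def)
    have "real (hilbert_fun f k) = a * real k + b"
      using P[of k] k 0[of d1] 0[of d2] 0[of d3] d by simp
    then show ?thesis by (simp add: mult.commute)
  qed
  have hp: "hilbert_poly f = [:b, a:]" by (rule hilbert_poly_eqI[OF P0])
  have st: "st f = d + d3 - 4"
    unfolding st_def hp
  proof (rule Least_equality)
    fix q assume q: "\<forall>k\<ge>q. real (hilbert_fun f k) = poly [:b, a:] (real k)"
    show "d + d3 - 4 \<le> q"
    proof (rule ccontr)
      assume *: "\<not> d + d3 - 4 \<le> q"
      \<comment> \<open>The last degree in which the term of \<open>d\<^sub>3\<close> is off: its argument is \<open>-4\<close>.\<close>
      define k where "k = d + d3 - 5"
      have k: "int k = int d + int d3 - 5" using d D(1) by (simp add: k_def)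
      have "k \<ge> q" using * by (simp add: k_def)
      then have "real (hilbert_fun f k) = a * real k + b" using q by (simp add: algebra_simps)
      moreover have "delta (int k - (int d - 1) - int d3) = 1" by (simp add: delta_def k)
      moreover have "delta n \<ge> 0" for n by (simp add: delta_def)
      ultimately show False using P[of k] k by (smt (verit))
    qed
  qed (use P0 in blast)
  have "int (ct f fs) = int d1 + int d - 2" if "homogeneous d fs" "smooth_surface fs" for fs
    using ct_free[OF f fr that d D(3)] d D(1) by simp
  moreover have "mdr f = d1" by (rule mdr_free[OF f fr d(2,3) D(3)])
  moreover have "int (st f) = int d + int d3 - 4" using st d D(1) by simp
  moreover have "\<forall>k. poly (hilbert_poly f) k = a * k + b" by (simp add: hp algebra_simps)
  ultimately show ?thesis
    using D(1) unfolding Let_def a_def b_def s1_def s2_def s3_def by simp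
qed

end
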